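(* Let $G$ be a connected cycle-disjoint graph with $n$ vertices, $m$ edges, and $c_1$ induced cycles of length congruent to $1$ modulo $3$. Then $\mathrm{diss}(G)= n-\frac{1}{3}(m+1+c_1)$ if and only if $G\in\mathcal{C}$.
   Context: A graph is cycle-disjoint if every two distinct cycles of it are vertex-disjoint. A set $D$ of vertices of a graph $G$ is a dissociation set if the induced subgraph $G[D]$ has maximum degree at most $1$; $\mathrm{diss}(G)$ is the maximum cardinality of a dissociation set. An induced cycle is a cycle subgraph $C$ with $G[V(C)]=C$. Spiked cycles: for positive integers $\ell,k$ with $\ell\geq\max\{3,k\}$ and indices $1\le i_1<\dots<i_k\le \ell$, the spiked cycle $C^*$ with $k$ spikes at $\{i_1,\dots,i_k\}$ arises from the cycle $u_1u_2\dots u_\ell u_1$ by adding, for each $j$, a new vertex $v_{i_j}$ adjacent only to $u_{i_j}$. It is good if either $k=1$ and $\ell\equiv 1\pmod 3$, or $k\ge 2$, $i_{j+1}-i_j\equiv 2\pmod 3$ for all $j\in\{1,\dots,k-1\}$, and $\ell+i_1-i_k\equiv 1\pmod 3$. It is very good if it is good and $\ell\not\equiv 1\pmod 3$. Operations on a graph $G'$: $(O_1)$ add new vertices $u,v,w$ with edges $uv,vw$ and an edge from $w$ to some vertex of $G'$; $(O_2)$ add new vertices $v,u,u'$ with edges $vu,vu'$ and an edge from $v$ to some vertex of $G'$; $(O_3)$ add a disjoint new cycle $C_\ell$ with $\ell\ge 3$, $\ell\not\equiv 0\pmod 3$, and an edge from some vertex of the cycle to some vertex of $G'$; $(O_4)$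 add a disjoint new very good spiked cycle $C^*$ and an edge between some vertex of $G'$ and some vertex of $C^*$. Let $\mathcal{C}_0$ consist of $P_3$, all cycles $C_\ell$ with $\ell\ge 3$ and $\ell\not\equiv 0\pmod 3$, and all very good spiked cycles. $\mathcal{C}$ is the set of all graphs obtained from graphs in $\mathcal{C}_0$ by finitely many (possibly zero) applications of the operations $(O_1)$, $(O_2)$, $(O_3)$, $(O_4)$. *)

theory Defs
  imports Complex_Main
begin

text \<open>A finite simple graph: vertex set V, edge set E of 2-element subsets of V.\<close>
definition graph :: "'a set \<Rightarrow> 'a set set \<Rightarrow> bool" where
  "graph V E \<longleftrightarrow> finite V \<and> (\<forall>e\<in>E. e \<subseteq> V \<and> card e = 2)"

definition connected_graph :: "'a set \<Rightarrow> 'a set set \<Rightarrow> bool" where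
  "connected_graph V E \<longleftrightarrow> V \<noteq> {} \<and>
     (\<forall>u\<in>V. \<forall>v\<in>V. (u, v) \<in> {(x, y). {x, y} \<in> E}\<^sup>*)"

text \<open>Edge set of the closed walk xs!0, xs!1, ..., xs!(l-1), xs!0.\<close>
definition cyc_edges :: "'a list \<Rightarrow> 'a set set" where
  "cyc_edges xs = {{xs ! i, xs ! ((i + 1) mod length xs)} | i. i < length xs}"

text \<open>xs lists the vertices of a cycle (subgraph) of G in cyclic order.\<close>
definition cyc_list :: "'a set \<Rightarrow> 'a set set \<Rightarrow> 'a list \<Rightarrow> bool" where
  "cyc_list V E xs \<longleftrightarrow> length xs \<ge> 3 \<and> distinct xs \<and> set xs \<subseteq> V \<and> cyc_edges xs \<subseteq> E"

text \<open>Two cycles are distinct subgraphs iff their edge sets differ.\<close>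
definition cycle_disjoint :: "'a set \<Rightarrow> 'a set set \<Rightarrow> bool" where
  "cycle_disjoint V E \<longleftrightarrow> (\<forall>xs ys. cyc_list V E xs \<and> cyc_list V E ys \<and>
       cyc_edges xs \<noteq> cyc_edges ys \<longrightarrow> set xs \<inter> set ys = {})"

definition induced_cycle :: "'a set \<Rightarrow> 'a set set \<Rightarrow> 'a list \<Rightarrow> bool" where
  "induced_cycle V E xs \<longleftrightarrow> cyc_list V E xs \<and> {e \<in> E. e \<subseteq> set xs} = cyc_edges xs"

text \<open>Number of induced cycles (counted as subgraphs, i.e. by vertex set) of length 1 mod 3.\<close>
definition c1 :: "'a set \<Rightarrow> 'a set set \<Rightarrow> nat" where
  "c1 V E = card {set xs | xs. induced_cycle V E xs \<and> length xs mod 3 = 1}"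

definition dissociation_set :: "'a set \<Rightarrow> 'a set set \<Rightarrow> 'a set \<Rightarrow> bool" where
  "dissociation_set V E D \<longleftrightarrow> D \<subseteq> V \<and> (\<forall>v\<in>D. card {u \<in> D. {u, v} \<in> E} \<le> 1)"

definition diss :: "'a set \<Rightarrow> 'a set set \<Rightarrow> nat" where
  "diss V E = Max {card D | D. dissociation_set V E D}"

text \<open>G is (isomorphic to) the cycle C_l.\<close>
definition cycle_graph :: "'a set \<Rightarrow> 'a set set \<Rightarrow> nat \<Rightarrow> bool" where
  "cycle_graph V E l \<longleftrightarrow> (\<exists>xs. length xs = l \<and> l \<ge> 3 \<and> distinct xs \<and>
       V = set xs \<and> E = cyc_edges xs)"

text \<open>Good / very good spike index sets, using 0-based indices I \<subseteq> {0..<l}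
  (differences and l + i_1 - i_k are unaffected by the shift).\<close>
definition good_spikes :: "nat \<Rightarrow> nat set \<Rightarrow> bool" where
  "good_spikes l I \<longleftrightarrow>
     (card I = 1 \<and> l mod 3 = 1) \<or>
     (card I \<ge> 2 \<and>
      (\<forall>i\<in>I. \<forall>j\<in>I. i < j \<and> (\<forall>t\<in>I. \<not> (i < t \<and> t < j)) \<longrightarrow> (j - i) mod 3 = 2) \<and>
      (l + Min I - Max I) mod 3 = 1)"

definition very_good_spikes :: "nat \<Rightarrow> nat set \<Rightarrow> bool" where
  "very_good_spikes l I \<longleftrightarrow> good_spikes l I \<and> l mod 3 \<noteq> 1"

text \<open>G is (isomorphic to) a very good spiked cycle: cycle us (length l), spikes w i at us!i, i \<in> I.\<close>
definition very_good_spiked_cycle :: "'a set \<Rightarrow> 'a set set \<Rightarrow> bool" where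
  "very_good_spiked_cycle V E \<longleftrightarrow> (\<exists>us I w.
     length us \<ge> 3 \<and> distinct us \<and> I \<noteq> {} \<and> I \<subseteq> {0..<length us} \<and>
     inj_on w I \<and> w ` I \<inter> set us = {} \<and>
     V = set us \<union> w ` I \<and>
     E = cyc_edges us \<union> {{us ! i, w i} | i. i \<in> I} \<and>
     very_good_spikes (length us) I)"

definition P3_graph :: "'a set \<Rightarrow> 'a set set \<Rightarrow> bool" where
  "P3_graph V E \<longleftrightarrow> (\<exists>a b c. distinct [a, b, c] \<and> V = {a, b, c} \<and> E = {{a, b}, {b, c}})"

inductive in_C :: "'a set \<Rightarrow> 'a set set \<Rightarrow> bool" where
  base_P3: "P3_graph V E \<Longrightarrow> in_C V E"
| base_cycle: "cycle_graph V E l \<Longrightarrow> l mod 3 \<noteq> 0 \<Longrightarrow> in_C V E"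
| base_spiked: "very_good_spiked_cycle V E \<Longrightarrow> in_C V E"
| O1: "in_C V E \<Longrightarrow> distinct [u, v, w] \<Longrightarrow> u \<notin> V \<Longrightarrow> v \<notin> V \<Longrightarrow> w \<notin> V \<Longrightarrow> x \<in> V \<Longrightarrow>
       in_C (V \<union> {u, v, w}) (E \<union> {{u, v}, {v, w}, {w, x}})"
| O2: "in_C V E \<Longrightarrow> distinct [v, u, u'] \<Longrightarrow> v \<notin> V \<Longrightarrow> u \<notin> V \<Longrightarrow> u' \<notin> V \<Longrightarrow> x \<in> V \<Longrightarrow>
       in_C (V \<union> {v, u, u'}) (E \<union> {{v, u}, {v, u'}, {v, x}})"
| O3: "in_C V E \<Longrightarrow> cycle_graph Vc Ec l \<Longrightarrow> l mod 3 \<noteq> 0 \<Longrightarrow> Vc \<inter> V = {} \<Longrightarrow>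
       y \<in> Vc \<Longrightarrow> x \<in> V \<Longrightarrow> in_C (V \<union> Vc) (E \<union> Ec \<union> {{x, y}})"
| O4: "in_C V E \<Longrightarrow> very_good_spiked_cycle Vs Es \<Longrightarrow> Vs \<inter> V = {} \<Longrightarrow>
       y \<in> Vs \<Longrightarrow> x \<in> V \<Longrightarrow> in_C (V \<union> Vs) (E \<union> Es \<union> {{x, y}})"

end

theory Submission
  imports Defs
begin

text \<open>
  For a vertex set \<open>W\<close> of a cycle-disjoint graph let the excess be
  \<open>3 diss(W) - 2 |W|\<close> plus the number of cycles in \<open>W\<close>, where cycles of length \<open>1\<close> modulo \<open>3\<close>
  count twice. If \<open>W\<close> is connected, its number of edges is \<open>|W| - 1\<close> plus the number of cycles,
  so the equation of the theorem says that the excess of \<open>V\<close> is \<open>0\<close>.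

  The excess is never negative and vanishes exactly on \<open>\<C>\<close>. Suppose that a connected \<open>W\<close> has
  excess at most \<open>0\<close> and that all smaller sets have nonnegative excess. A bridge with sides \<open>A\<close> and
  \<open>B\<close> costs at most \<open>3\<close>, and nothing if one side has excess \<open>0\<close>, because every vertex of such a
  side is avoided by some maximum dissociation set. Hence either some bridge has two sides of excess
  \<open>0\<close>, and \<open>W\<close> is a join of two members of \<open>\<C>\<close>, or one side has excess \<open>1\<close>; deleting its end of
  the bridge then leaves components of excess \<open>0\<close>, which would be sides of bridges, so this side is
  a single vertex. If every bridge is pendant,
  \<open>W\<close> is a star or a cycle with pendant vertices. Deleting a cycle vertex bounds the number of its
  spikes, and what remains is a caterpillar of excess \<open>0\<close>, which is partitioned into paths with
  three vertices. Comparing these partitions for all spiked vertices makes the spiked cycle very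
  good. Conversely, such partitions give the upper bounds on the dissociation number of the pieces.
\<close>

section \<open>Cycles as lists\<close>

text \<open>The theorem concerns connected graphs, but deleting a vertex leaves arbitrary induced
  subgraphs. Therefore the excess is defined for all vertex sets of one fixed graph, and its
  nonnegativity, also for disconnected sets, is proved in the same induction as the classification.

  The constants balance a deletion. A deleted vertex costs at most \<open>2\<close>, each vertex of
  a dissociation set that is left over returns \<open>3 - 2 = 1\<close>, and a destroyed cycle
  returns its weight. So opening a cycle of length \<open>1\<close> modulo \<open>3\<close> is free,
  which leaves no room for a spike in a set of excess at most \<open>0\<close>; for other lengths it
  costs \<open>1\<close>, which one spike pays exactly. Likewise, if deleting a vertex lowered the
  dissociation number of a side of excess \<open>0\<close>, the excess would change by
  \<open>-3 + 2\<close> and become negative.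

  For the upper bound on a spiked cycle, paths with three vertices leave two vertices over, and a
  dissociation set must be shown to use at most one of them. Which two are left over has to depend
  on the dissociation set.\<close>

lemma cyc_edges_mod:
  assumes "xs \<noteq> []"
  shows "cyc_edges xs = {{xs ! (n mod length xs), xs ! (Suc n mod length xs)} | n. True}"
proof -
  have l: "0 < length xs" using assms by simp
  show ?thesis
  proof (intro set_eqI iffI)
    fix e assume "e \<in> cyc_edges xs"
    then obtain i where "i < length xs" "e = {xs ! i, xs ! ((i + 1) mod length xs)}"
      unfolding cyc_edges_def by blast
    then show "e \<in> {{xs ! (n mod length xs), xs ! (Suc n mod length xs)} | n. True}"
      by (auto intro!: exI[of _ i])
  next
    fix e assume "e \<in> {{xs ! (n mod length xs), xs ! (Suc n mod length xs)} | n. True}"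
    then obtain n where n: "e = {xs ! (n mod length xs), xs ! (Suc n mod length xs)}" by blast
    have "(n mod length xs + 1) mod length xs = Suc n mod length xs"
      by (simp add: mod_Suc_eq)
    then show "e \<in> cyc_edges xs" unfolding cyc_edges_def
      using n l by (auto intro!: exI[of _ "n mod length xs"])
  qed
qed

lemma cyc_edges_sub: "e \<in> cyc_edges xs \<Longrightarrow> e \<subseteq> set xs"
  unfolding cyc_edges_def by (auto intro!: nth_mem mod_less_divisor)

lemma Union_cyc_edges: "\<Union> (cyc_edges xs) = set xs"
proof
  show "\<Union> (cyc_edges xs) \<subseteq> set xs" using cyc_edges_sub by fastforce
  show "set xs \<subseteq> \<Union> (cyc_edges xs)"
  proof
    fix x assume "x \<in> set xs"
    then obtain i where i: "i < length xs" "x = xs ! i" by (metis in_set_conv_nth)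
    then have "{xs ! i, xs ! ((i + 1) mod length xs)} \<in> cyc_edges xs"
      unfolding cyc_edges_def by blast
    then show "x \<in> \<Union> (cyc_edges xs)" using i by blast
  qed
qed

text \<open>If two positions gave the same edge, each would be the successor of the other modulo the
  length, which is impossible from length \<open>3\<close> on.\<close>

lemma card_cyc_edges:
  assumes d: "distinct xs" and l: "3 \<le> length xs"
  shows "card (cyc_edges xs) = length xs"
proof -
  let ?l = "length xs"
  let ?g = "\<lambda>i. {xs ! i, xs ! ((i + 1) mod ?l)}"
  have "inj_on ?g {..<?l}"
  proof (rule inj_onI)
    fix i j assume i: "i \<in> {..<?l}" and j: "j \<in> {..<?l}" and eq: "?g i = ?g j"
    show "i = j"
    proof (rule ccontr)
      assume ne: "i \<noteq> j"
      have lt: "(i + 1) mod ?l < ?l" "(j + 1) mod ?l < ?l" using l by (auto intro!: mod_less_divisor)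
      have "xs ! i = xs ! ((j + 1) mod ?l)" "xs ! j = xs ! ((i + 1) mod ?l)"
        using eq ne i j d by (auto simp: doubleton_eq_iff nth_eq_iff_index_eq)
      then have "i = (j + 1) mod ?l" "j = (i + 1) mod ?l"
        using i j lt d by (auto simp: nth_eq_iff_index_eq)
      then show False using i j l
        by (auto simp: mod_if split: if_splits)
    qed
  qed
  moreover have "cyc_edges xs = ?g ` {..<?l}" unfolding cyc_edges_def by auto
  ultimately show ?thesis by (simp add: card_image)
qed

text \<open>Otherwise \<open>P\<close> would persist from \<open>i\<close> onwards, up to a later
  number with the residue of \<open>j\<close>. Applied to a closed walk, this finds a step that
  leaves a given set.\<close>

lemma periodic_switch:
  fixes P :: "nat \<Rightarrow> bool"
  assumes "P i" "\<not> P (j mod l)" and per: "\<And>n. P n = P (n mod l)" and "0 < l"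
  shows "\<exists>n. P n \<and> \<not> P (Suc n)"
proof (rule ccontr)
  assume "\<not> ?thesis"
  then have step: "\<And>n. P n \<Longrightarrow> P (Suc n)" by blast
  have "P (i + k)" for k by (induction k) (use \<open>P i\<close> step in auto)
  moreover have "i \<le> j + l * i" using \<open>0 < l\<close> by (simp add: trans_le_add2)
  ultimately have "P (j + l * i)" by (metis le_add_diff_inverse)
  then show False using per[of "j + l * i"] assms(2) by simp
qed

text \<open>The path stays free of repetitions by being cut back to the earlier visit whenever its
  new end point already occurs on it.\<close>

lemma rtrancl_distinct_path:
  assumes "(a, b) \<in> R\<^sup>*"
  shows "\<exists>xs. xs \<noteq> [] \<and> hd xs = a \<and> last xs = b \<and> distinct xs \<and> successively (\<lambda>x y. (x, y) \<in> R) xs"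
  using assms
proof (induction rule: rtrancl_induct)
  case base
  show ?case by (rule exI[of _ "[a]"]) simp
next
  case (step b c)
  then obtain xs where xs: "xs \<noteq> []" "hd xs = a" "last xs = b" "distinct xs"
    "successively (\<lambda>x y. (x, y) \<in> R) xs" by blast
  show ?case
  proof (cases "c \<in> set xs")
    case True
    then obtain ys zs where "xs = ys @ c # zs" by (meson split_list)
    then have "ys @ [c] \<noteq> []" "hd (ys @ [c]) = a" "last (ys @ [c]) = c" "distinct (ys @ [c])"
      "successively (\<lambda>x y. (x, y) \<in> R) (ys @ [c])"
      using xs by (auto simp: successively_append_iff hd_append)
    then show ?thesis by blast
  next
    case False
    then have "xs @ [c] \<noteq> []" "hd (xs @ [c]) = a" "last (xs @ [c]) = c" "distinct (xs @ [c])"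
      "successively (\<lambda>x y. (x, y) \<in> R) (xs @ [c])"
      using xs step by (auto simp: successively_append_iff)
    then show ?thesis by blast
  qed
qed

section \<open>Excess\<close>

locale cycle_disjoint_graph =
  fixes V :: "'a set" and E :: "'a set set"
  assumes graph: "graph V E" and disjoint: "cycle_disjoint V E"
begin

lemma finite_V: "finite V" using graph by (simp add: graph_def)

lemma finite_sub: "W \<subseteq> V \<Longrightarrow> finite W" using finite_V finite_subset by blast

lemma edge_neq: "{x, y} \<in> E \<Longrightarrow> x \<noteq> y"
  using graph by (fastforce simp: graph_def)

lemma edge_in_V: "{x, y} \<in> E \<Longrightarrow> x \<in> V \<and> y \<in> V"
  using graph by (auto simp: graph_def)

lemma edge_sym: "{x, y} \<in> E \<longleftrightarrow> {y, x} \<in> E" by (simp add: insert_commute)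

definition dissoc :: "'a set \<Rightarrow> bool" where
  "dissoc D \<longleftrightarrow> (\<forall>v\<in>D. card {u \<in> D. {u, v} \<in> E} \<le> 1)"

text \<open>The dissociation number of the subgraph induced by \<open>W\<close>. All sets share the
  ambient \<open>E\<close>, so no subgraph has to be shown cycle-disjoint again.\<close>

definition dd :: "'a set \<Rightarrow> nat" where
  "dd W = Max {card D | D. D \<subseteq> W \<and> dissoc D}"

text \<open>Recording a cycle by its vertex set loses nothing here: cycles with a common vertex have
  the same edges.\<close>

definition cycles :: "'a set \<Rightarrow> 'a set set" where
  "cycles W = {set xs | xs. cyc_list W E xs}"

definition weight :: "'a set \<Rightarrow> int" where
  "weight C = (if card C mod 3 = 1 then 2 else 1)"

definition cycle_weight :: "'a set \<Rightarrow> int" where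
  "cycle_weight W = sum weight (cycles W)"

definition excess :: "'a set \<Rightarrow> int" where
  "excess W = 3 * int (dd W) + cycle_weight W - 2 * int (card W)"

text \<open>Connectedness as the absence of an uncrossed cut, a form that suits splitting and
  joining of vertex sets.\<close>

definition conn :: "'a set \<Rightarrow> bool" where
  "conn W \<longleftrightarrow> W \<noteq> {} \<and> (\<forall>A B. W = A \<union> B \<and> A \<inter> B = {} \<and> A \<noteq> {} \<and> B \<noteq> {} \<longrightarrow>
     (\<exists>a\<in>A. \<exists>b\<in>B. {a, b} \<in> E))"

text \<open>The edge comes with its two sides because their excesses are to be compared. Connected
  sides are demanded separately where they matter.\<close>

definition bridge :: "'a set \<Rightarrow> 'a set \<Rightarrow> 'a \<Rightarrow> 'a \<Rightarrow> bool" where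
  "bridge A B a b \<longleftrightarrow> A \<inter> B = {} \<and> a \<in> A \<and> b \<in> B \<and> {a, b} \<in> E \<and>
     (\<forall>u\<in>A. \<forall>v\<in>B. {u, v} \<in> E \<longrightarrow> u = a \<and> v = b)"

section \<open>Dissociation numbers of vertex sets\<close>

lemma dissoc_mono: "dissoc D \<Longrightarrow> D' \<subseteq> D \<Longrightarrow> finite D \<Longrightarrow> dissoc D'"
  unfolding dissoc_def
proof
  fix v assume *: "\<forall>v\<in>D. card {u \<in> D. {u, v} \<in> E} \<le> 1" "D' \<subseteq> D" "finite D" "v \<in> D'"
  have "card {u \<in> D'. {u, v} \<in> E} \<le> card {u \<in> D. {u, v} \<in> E}"
    by (rule card_mono) (use * in auto)
  with * show "card {u \<in> D'. {u, v} \<in> E} \<le> 1" by force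
qed

lemma dissoc_card_le_2:
  assumes "finite D" "card D \<le> 2"
  shows "dissoc D"
  unfolding dissoc_def
proof
  fix v assume "v \<in> D"
  have "card {u \<in> D. {u, v} \<in> E} \<le> card (D - {v})"
    by (rule card_mono) (use assms edge_neq in auto)
  also have "\<dots> \<le> 1" using assms \<open>v \<in> D\<close> by simp
  finally show "card {u \<in> D. {u, v} \<in> E} \<le> 1" .
qed

lemma dissoc_independent:
  assumes "\<And>u v. u \<in> D \<Longrightarrow> v \<in> D \<Longrightarrow> {u, v} \<notin> E"
  shows "dissoc D"
proof -
  have "card {u \<in> D. {u, v} \<in> E} = 0" if "v \<in> D" for v
    using assms that by (metis (no_types, lifting) Collect_empty_eq card.empty)
  then show ?thesis by (simp add: dissoc_def)
qed

lemma dissoc_union: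
  assumes "dissoc A" "dissoc B" and no: "\<And>u v. u \<in> A \<Longrightarrow> v \<in> B \<Longrightarrow> {u, v} \<notin> E"
  shows "dissoc (A \<union> B)"
  unfolding dissoc_def
proof
  fix v assume v: "v \<in> A \<union> B"
  show "card {u \<in> A \<union> B. {u, v} \<in> E} \<le> 1"
  proof (cases "v \<in> A")
    case True
    then have "{u \<in> A \<union> B. {u, v} \<in> E} = {u \<in> A. {u, v} \<in> E}" using no edge_sym by blast
    then show ?thesis using assms True by (auto simp: dissoc_def)
  next
    case False
    then have "{u \<in> A \<union> B. {u, v} \<in> E} = {u \<in> B. {u, v} \<in> E}" using no v by blast
    then show ?thesis using assms False v by (auto simp: dissoc_def)
  qed
qed

lemma not_dissoc_path:
  assumes "finite D" "{x, y} \<in> E" "{z, y} \<in> E" "x \<noteq> z" "x \<in> D" "y \<in> D" "z \<in> D"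
  shows "\<not> dissoc D"
proof
  assume "dissoc D"
  then have "card {u \<in> D. {u, y} \<in> E} \<le> 1" using assms by (auto simp: dissoc_def)
  moreover have "card {x, z} \<le> card {u \<in> D. {u, y} \<in> E}"
    by (rule card_mono) (use assms in auto)
  ultimately show False using assms by auto
qed

lemma dd_set:
  assumes "finite W"
  shows "finite {card D | D. D \<subseteq> W \<and> dissoc D}" "{card D | D. D \<subseteq> W \<and> dissoc D} \<noteq> {}"
proof -
  have "{card D | D. D \<subseteq> W \<and> dissoc D} \<subseteq> card ` Pow W" by auto
  then show "finite {card D | D. D \<subseteq> W \<and> dissoc D}" using assms by (simp add: finite_subset)
  have "dissoc {}" by (simp add: dissoc_def)
  then show "{card D | D. D \<subseteq> W \<and> dissoc D} \<noteq> {}" by blast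
qed

lemma dd_ge: "finite W \<Longrightarrow> D \<subseteq> W \<Longrightarrow> dissoc D \<Longrightarrow> card D \<le> dd W"
  unfolding dd_def by (rule Max_ge) (use dd_set in auto)

lemma dd_obtain:
  assumes "finite W"
  obtains D where "D \<subseteq> W" "dissoc D" "card D = dd W"
  using Max_in[OF dd_set[OF assms]] unfolding dd_def by auto

lemma dd_le_card: "finite W \<Longrightarrow> dd W \<le> card W"
  by (metis card_mono dd_obtain)

lemma dd_mono:
  assumes "finite W" "U \<subseteq> W"
  shows "dd U \<le> dd W"
proof -
  obtain D where "D \<subseteq> U" "dissoc D" "card D = dd U"
    using dd_obtain finite_subset[OF assms(2,1)] by metis
  then show ?thesis using dd_ge[OF assms(1), of D] assms by auto
qed

lemma dd_subadd:
  assumes "finite A" "finite B"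
  shows "dd (A \<union> B) \<le> dd A + dd B"
proof -
  have fin: "finite (A \<union> B)" using assms by simp
  obtain D where D: "D \<subseteq> A \<union> B" "dissoc D" "card D = dd (A \<union> B)"
    using dd_obtain[OF fin] by metis
  have finD: "finite D" using D fin finite_subset by blast
  have "card D \<le> card (D \<inter> A) + card (D \<inter> B)"
    using D card_Un_le[of "D \<inter> A" "D \<inter> B"] by (metis Int_Un_distrib inf.absorb_iff1)
  also have "card (D \<inter> A) \<le> dd A"
    by (rule dd_ge) (use assms D dissoc_mono finD in auto)
  also have "card (D \<inter> B) \<le> dd B"
    by (rule dd_ge) (use assms D dissoc_mono finD in auto)
  finally show ?thesis using D by simp
qed

lemma dd_add:
  assumes "finite A" "finite B" "A \<inter> B = {}"
    and no: "\<And>u v. u \<in> A \<Longrightarrow> v \<in> B \<Longrightarrow> {u, v} \<notin> E"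
  shows "dd (A \<union> B) = dd A + dd B"
proof (rule antisym)
  show "dd (A \<union> B) \<le> dd A + dd B" using dd_subadd assms by blast
  obtain D where D: "D \<subseteq> A" "dissoc D" "card D = dd A" using dd_obtain assms by metis
  obtain D' where D': "D' \<subseteq> B" "dissoc D'" "card D' = dd B" using dd_obtain assms by metis
  have "dissoc (D \<union> D')" by (rule dissoc_union) (use D D' no in auto)
  then have "card (D \<union> D') \<le> dd (A \<union> B)" using assms D D' by (intro dd_ge) auto
  moreover have "card (D \<union> D') = card D + card D'"
    using assms D D' by (intro card_Un_disjoint) (auto intro: finite_subset)
  ultimately show "dd A + dd B \<le> dd (A \<union> B)" using D D' by simp
qed

lemma dd_dissoc: "finite W \<Longrightarrow> dissoc W \<Longrightarrow> dd W = card W"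
  using dd_ge[of W W] dd_le_card[of W] by simp

lemma dd_remove:
  assumes "finite W" "x \<in> W"
  shows "dd W \<le> dd (W - {x}) + 1"
proof -
  have "dd W \<le> dd (W - {x}) + dd {x}"
    using dd_subadd[of "W - {x}" "{x}"] assms by (simp add: insert_absorb)
  also have "dd {x} \<le> 1" using dd_le_card[of "{x}"] by simp
  finally show ?thesis by simp
qed

section \<open>Cycles inside a vertex set\<close>

lemma cyc_list_mono: "cyc_list U E xs \<Longrightarrow> U \<subseteq> W \<Longrightarrow> cyc_list W E xs"
  unfolding cyc_list_def by auto

lemma cycles_sub: "C \<in> cycles W \<Longrightarrow> C \<subseteq> W"
  unfolding cycles_def cyc_list_def by auto

lemma cycles_card: "C \<in> cycles W \<Longrightarrow> 3 \<le> card C"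
  unfolding cycles_def cyc_list_def by (auto simp: distinct_card)

lemma cycles_mono: "U \<subseteq> W \<Longrightarrow> cycles U \<subseteq> cycles W"
  unfolding cycles_def using cyc_list_mono by blast

lemma cycles_restrict: "C \<in> cycles W \<Longrightarrow> C \<subseteq> U \<Longrightarrow> C \<in> cycles U"
  unfolding cycles_def cyc_list_def by blast

lemma finite_cycles: "finite W \<Longrightarrow> finite (cycles W)"
  by (rule finite_subset[of _ "Pow W"]) (auto dest: cycles_sub)

lemma weight_pos: "1 \<le> weight C" by (simp add: weight_def)

lemma cycle_weight_mono:
  assumes "finite W" "U \<subseteq> W"
  shows "cycle_weight U \<le> cycle_weight W"
  unfolding cycle_weight_def
  by (rule sum_mono2) (use assms finite_cycles cycles_mono weight_pos in \<open>auto intro: order_trans[OF zero_le_one]\<close>)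

lemma cycle_weight_nonneg: "0 \<le> cycle_weight W"
  unfolding cycle_weight_def by (rule sum_nonneg) (use weight_pos in \<open>auto intro: order_trans[OF zero_le_one]\<close>)

text \<open>Cycle-disjointness enters the argument only here. Equal edge sets give equal vertex sets
  because the edges of a cycle cover its vertices.\<close>

lemma cyc_list_meet:
  assumes "cyc_list V E xs" "cyc_list V E ys" "set xs \<inter> set ys \<noteq> {}"
  shows "cyc_edges xs = cyc_edges ys" "set xs = set ys"
proof -
  show "cyc_edges xs = cyc_edges ys" using disjoint assms unfolding cycle_disjoint_def by blast
  then show "set xs = set ys" by (metis Union_cyc_edges)
qed

lemma cycles_meet:
  assumes "C \<in> cycles V" "C' \<in> cycles V" "C \<inter> C' \<noteq> {}"
  shows "C = C'"
  using assms cyc_list_meet unfolding cycles_def by blast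

text \<open>A cycle that meets both sides steps from \<open>A\<close> to \<open>B\<close> and also
  back from \<open>B\<close> to \<open>A\<close>. Both steps use the same edge, in opposite
  directions, so its length divides \<open>2\<close>.\<close>

lemma cycle_not_cross:
  assumes xs: "cyc_list (A \<union> B) E xs" and AB: "A \<inter> B = {}"
    and no: "\<And>u v. u \<in> A \<Longrightarrow> v \<in> B \<Longrightarrow> {u, v} \<in> E \<Longrightarrow> u = a \<and> v = b"
  shows "set xs \<subseteq> A \<or> set xs \<subseteq> B"
proof (rule ccontr)
  assume neg: "\<not> ?thesis"
  let ?l = "length xs"
  let ?g = "\<lambda>n. xs ! (n mod ?l)"
  have l: "3 \<le> ?l" and dist: "distinct xs" and sub: "set xs \<subseteq> A \<union> B" and ed: "cyc_edges xs \<subseteq> E"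
    using xs by (auto simp: cyc_list_def)
  have ne: "xs \<noteq> []" using l by auto
  have mem: "?g n \<in> set xs" for n using l by (auto intro!: nth_mem mod_less_divisor)
  have edge: "{?g n, ?g (Suc n)} \<in> E" for n using ed cyc_edges_mod[OF ne] by blast
  obtain i j where ij: "i < ?l" "xs ! i \<in> A" "j < ?l" "xs ! j \<in> B"
    using neg sub by (auto simp: in_set_conv_nth subset_iff)
  have notB: "xs ! j \<notin> A" "xs ! i \<notin> B" "xs \<noteq> []" using ij AB l by auto
  obtain p where p: "?g p \<in> A" "?g (Suc p) \<notin> A"
    using periodic_switch[of "\<lambda>n. ?g n \<in> A" i j ?l] ij notB by auto
  obtain q where q: "?g q \<in> B" "?g (Suc q) \<notin> B"
    using periodic_switch[of "\<lambda>n. ?g n \<in> B" j i ?l] ij notB by auto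
  have "?g p = a \<and> ?g (Suc p) = b" using no[OF p(1) _ edge] p mem sub by blast
  moreover have "?g (Suc q) = a \<and> ?g q = b" using no[of "?g (Suc q)" "?g q"] q mem sub edge edge_sym by blast
  ultimately have "?g p = ?g (Suc q)" "?g (Suc p) = ?g q" by auto
  moreover have "n mod ?l < ?l" for n using l by (intro mod_less_divisor) linarith
  ultimately have e: "p mod ?l = Suc q mod ?l" "Suc p mod ?l = q mod ?l"
    using dist by (auto simp: nth_eq_iff_index_eq)
  have "Suc (Suc p) mod ?l = p mod ?l" using e by (metis mod_Suc_eq)
  then have "?l dvd 2" using mod_eq_dvd_iff_nat[of p "Suc (Suc p)" ?l] by (auto simp: numeral_2_eq_2)
  then show False using l by (auto dest: dvd_imp_le)
qed

text \<open>With no edges at all between \<open>A\<close> and \<open>B\<close> the second assumption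
  holds for any \<open>a\<close> and \<open>b\<close>, so disconnected unions are covered as well as
  bridges.\<close>

lemma cycles_union:
  assumes "A \<inter> B = {}" and "\<And>u v. u \<in> A \<Longrightarrow> v \<in> B \<Longrightarrow> {u, v} \<in> E \<Longrightarrow> u = a \<and> v = b"
  shows "cycles (A \<union> B) = cycles A \<union> cycles B"
proof
  show "cycles (A \<union> B) \<subseteq> cycles A \<union> cycles B"
  proof
    fix C assume C: "C \<in> cycles (A \<union> B)"
    then obtain xs where xs: "C = set xs" "cyc_list (A \<union> B) E xs" unfolding cycles_def by blast
    have "set xs \<subseteq> A \<or> set xs \<subseteq> B"
      using cycle_not_cross[OF xs(2) assms(1), of a b] assms(2) by blast
    then show "C \<in> cycles A \<union> cycles B" using C xs cycles_restrict by blast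
  qed
  show "cycles A \<union> cycles B \<subseteq> cycles (A \<union> B)" by (simp add: cycles_mono)
qed

lemma cycles_disjoint:
  assumes "A \<inter> B = {}"
  shows "cycles A \<inter> cycles B = {}"
proof -
  have False if "C \<in> cycles A" "C \<in> cycles B" for C
    using cycles_sub[OF that(1)] cycles_sub[OF that(2)] cycles_card[OF that(1)] assms
    by (metis Int_greatest card.empty not_numeral_le_zero subset_empty)
  then show ?thesis by blast
qed

lemma cycle_weight_union:
  assumes "finite A" "finite B" "A \<inter> B = {}"
    and "\<And>u v. u \<in> A \<Longrightarrow> v \<in> B \<Longrightarrow> {u, v} \<in> E \<Longrightarrow> u = a \<and> v = b"
  shows "cycle_weight (A \<union> B) = cycle_weight A + cycle_weight B"
proof -
  have *: "cycles (A \<union> B) = cycles A \<union> cycles B"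
    using cycles_union[of A B a b] assms by blast
  show ?thesis unfolding cycle_weight_def *
    by (rule sum.union_disjoint) (use assms finite_cycles cycles_disjoint in auto)
qed

section \<open>The excess under unions and deletions\<close>

lemma excess_add:
  assumes "finite A" "finite B" "A \<inter> B = {}"
    and no: "\<And>u v. u \<in> A \<Longrightarrow> v \<in> B \<Longrightarrow> {u, v} \<notin> E"
  shows "excess (A \<union> B) = excess A + excess B"
  using cycle_weight_union[of A B] dd_add[OF assms] assms card_Un_disjoint[of A B]
  by (auto simp: excess_def)

text \<open>Across a single edge cardinalities and cycle weights add up while \<open>dd\<close> is
  subadditive. Hence a join of sets of excess at most \<open>0\<close> again has excess at most
  \<open>0\<close>.\<close>

lemma excess_join_le:
  assumes "finite A" "finite B" "A \<inter> B = {}"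
    and "\<And>u v. u \<in> A \<Longrightarrow> v \<in> B \<Longrightarrow> {u, v} \<in> E \<Longrightarrow> u = a \<and> v = b"
  shows "excess (A \<union> B) \<le> excess A + excess B"
  using cycle_weight_union[OF assms] dd_subadd[of A B] assms card_Un_disjoint[of A B]
  by (auto simp: excess_def)

text \<open>Deleting \<open>x\<close> cannot raise \<open>dd\<close>, so only the vertex count,
  worth \<open>2\<close>, and the cycles through \<open>x\<close> matter.\<close>

lemma excess_remove_le:
  assumes "finite W" "x \<in> W"
  shows "excess (W - {x}) - 2 + (cycle_weight W - cycle_weight (W - {x})) \<le> excess W"
proof -
  have "card W = card (W - {x}) + 1" using assms card_Suc_Diff1 by fastforce
  then show ?thesis using dd_mono[of W "W - {x}"] assms by (auto simp: excess_def)
qed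

lemma excess_dissoc: "finite W \<Longrightarrow> dissoc W \<Longrightarrow> int (card W) \<le> excess W"
  using cycle_weight_nonneg[of W] by (simp add: excess_def dd_dissoc)

text \<open>Deleting \<open>z\<close> costs at most \<open>2\<close> and separates \<open>A\<close>
  from \<open>B\<close>; each vertex of the dissociation set \<open>A\<close> then contributes at
  least \<open>1\<close>. This is the estimate behind stars and caterpillars.\<close>

lemma excess_peel:
  assumes "finite A" "finite B" "z \<notin> A" "z \<notin> B" "A \<inter> B = {}" "dissoc A"
    and no: "\<And>u v. u \<in> A \<Longrightarrow> v \<in> B \<Longrightarrow> {u, v} \<notin> E"
  shows "int (card A) + excess B - 2 \<le> excess (insert z (A \<union> B))"
proof -
  have "insert z (A \<union> B) - {z} = A \<union> B" using assms by auto
  then have "excess (A \<union> B) - 2 \<le> excess (insert z (A \<union> B))"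
    using excess_remove_le[of "insert z (A \<union> B)" z] assms
      cycle_weight_mono[of "insert z (A \<union> B)" "A \<union> B"] by fastforce
  then show ?thesis using excess_add[OF assms(1,2,5) no] excess_dissoc[of A] assms by auto
qed

section \<open>Bridges\<close>

text \<open>A repetition-free path from \<open>a\<close> to \<open>b\<close> that avoids the edge is
  closed by it. The path has a third vertex, since its only step would otherwise be the edge
  itself.\<close>

lemma cycle_through_edge:
  assumes e: "{a, b} \<in> E" and "a \<in> W" and W: "R \<subseteq> W \<times> W"
    and R: "\<And>x y. (x, y) \<in> R \<Longrightarrow> {x, y} \<in> E \<and> {x, y} \<noteq> {a, b}" and ab: "(a, b) \<in> R\<^sup>*"
  shows "\<exists>xs. cyc_list W E xs \<and> {a, b} \<in> cyc_edges xs"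
proof -
  obtain xs where xs: "xs \<noteq> []" "hd xs = a" "last xs = b" "distinct xs"
    "successively (\<lambda>x y. (x, y) \<in> R) xs" using rtrancl_distinct_path[OF ab] by blast
  have step: "(xs ! i, xs ! Suc i) \<in> R" if "Suc i < length xs" for i
    using xs(5) that by (simp add: successively_conv_nth)
  have h: "xs ! 0 = a" "xs ! (length xs - 1) = b" using xs by (auto simp: hd_conv_nth last_conv_nth)
  have l: "3 \<le> length xs"
  proof (rule ccontr)
    assume "\<not> ?thesis"
    then consider "length xs = 1" | "length xs = 2" using xs(1)
      by (metis One_nat_def Suc_1 Suc_leI le_antisym length_greater_0_conv not_less_eq_eq numeral_3_eq_3)
    then show False
    proof cases
      case 1 then show False using h edge_neq[OF e] by simp
    next
      case 2 then show False using step[of 0] h R[of a b] by simp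
    qed
  qed
  have nth_W: "xs ! i \<in> W" if "i < length xs" for i
  proof (cases i)
    case 0 then show ?thesis using h \<open>a \<in> W\<close> by simp
  next
    case (Suc k) then show ?thesis using step[of k] that W by auto
  qed
  have last_e: "{xs ! (length xs - 1), xs ! ((length xs - 1 + 1) mod length xs)} = {a, b}"
  proof -
    have "length xs - 1 + 1 = length xs" using l by simp
    then have "(length xs - 1 + 1) mod length xs = 0" by (metis mod_self)
    then show ?thesis using h by (simp only: insert_commute)
  qed
  have "{xs ! i, xs ! ((i + 1) mod length xs)} \<in> E" if "i < length xs" for i
  proof (cases "Suc i < length xs")
    case True then show ?thesis using step[OF True] R by simp
  next
    case False
    then have "i = length xs - 1" using that by simp
    then show ?thesis using last_e e by metis
  qed
  then have "cyc_edges xs \<subseteq> E" unfolding cyc_edges_def by blast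
  moreover have "{a, b} \<in> cyc_edges xs" unfolding cyc_edges_def
    using last_e l by (intro CollectI exI[of _ "length xs - 1"]) auto
  moreover have "set xs \<subseteq> W" using nth_W by (auto simp: in_set_conv_nth)
  ultimately show ?thesis using l xs unfolding cyc_list_def by blast
qed

text \<open>\<open>A\<close> consists of the vertices reachable from \<open>a\<close> without the
  edge. If it contains \<open>b\<close>, the edge lies on a cycle; otherwise no other edge leaves
  \<open>A\<close>.\<close>

lemma edge_cases:
  assumes "conn W" "{a, b} \<in> E" "a \<in> W" "b \<in> W"
  obtains (cycle) xs where "cyc_list W E xs" "{a, b} \<in> cyc_edges xs"
  | (bridge) A B where "W = A \<union> B" "bridge A B a b" "conn A" "conn B"
proof (cases "\<exists>xs. cyc_list W E xs \<and> {a, b} \<in> cyc_edges xs")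
  case True then show ?thesis using cycle by blast
next
  case False
  define R where "R = {(x, y). x \<in> W \<and> y \<in> W \<and> {x, y} \<in> E \<and> {x, y} \<noteq> {a, b}}"
  define A where "A = {x. (a, x) \<in> R\<^sup>*}"
  define B where "B = W - A"
  have "(a, b) \<notin> R\<^sup>*"
    using cycle_through_edge[of a b W R] assms False unfolding R_def by blast
  then have b: "b \<in> B" using assms by (auto simp: B_def A_def)
  have a: "a \<in> A" by (simp add: A_def)
  have "x \<in> W" if "(a, x) \<in> R\<^sup>*" for x
    using that by (induction rule: rtrancl_induct) (use assms in \<open>auto simp: R_def\<close>)
  then have AW: "A \<subseteq> W" by (auto simp: A_def)
  have W: "W = A \<union> B" and dis: "A \<inter> B = {}" using AW by (auto simp: B_def)
  have cross: "u = a \<and> v = b" if "u \<in> A" "v \<in> B" "{u, v} \<in> E" for u v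
  proof -
    have "(u, v) \<notin> R"
    proof
      assume "(u, v) \<in> R"
      then have "v \<in> A" using that(1) unfolding A_def by (auto intro: rtrancl_into_rtrancl)
      then show False using that dis by blast
    qed
    then have "{u, v} = {a, b}" using that W unfolding R_def by blast
    then show ?thesis using that a b dis by (auto simp: doubleton_eq_iff)
  qed
  have br: "bridge A B a b" unfolding bridge_def using dis a b assms cross by blast
  have "conn A" unfolding conn_def
  proof (intro conjI allI impI)
    show "A \<noteq> {}" using a by blast
    fix P Q assume PQ: "A = P \<union> Q \<and> P \<inter> Q = {} \<and> P \<noteq> {} \<and> Q \<noteq> {}"
    have key: "\<exists>p\<in>S. \<exists>q\<in>T. {p, q} \<in> E" if "A = S \<union> T" "S \<inter> T = {}" "T \<noteq> {}" "a \<in> S" for S T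
    proof (rule ccontr)
      assume neg: "\<not> ?thesis"
      have "x \<in> S" if "(a, x) \<in> R\<^sup>*" for x using that
      proof (induction rule: rtrancl_induct)
        case base show ?case by fact
      next
        case (step y z)
        then have "z \<in> A" unfolding A_def by (auto intro: rtrancl_into_rtrancl)
        moreover have "{y, z} \<in> E" using step by (auto simp: R_def)
        ultimately show ?case using neg step \<open>A = S \<union> T\<close> by blast
      qed
      then have "A \<subseteq> S" by (auto simp: A_def)
      then show False using that by blast
    qed
    show "\<exists>p\<in>P. \<exists>q\<in>Q. {p, q} \<in> E"
    proof (cases "a \<in> P")
      case True then show ?thesis using key[of P Q] PQ by blast
    next
      case False
      then have "\<exists>p\<in>Q. \<exists>q\<in>P. {p, q} \<in> E" using key[of Q P] PQ a by blast
      then show ?thesis using edge_sym by blast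
    qed
  qed
  moreover have "conn B" unfolding conn_def
  proof (intro conjI allI impI)
    show "B \<noteq> {}" using b by blast
    fix P Q assume PQ: "B = P \<union> Q \<and> P \<inter> Q = {} \<and> P \<noteq> {} \<and> Q \<noteq> {}"
    have key: "\<exists>p\<in>S. \<exists>q\<in>T. {p, q} \<in> E" if "B = S \<union> T" "S \<inter> T = {}" "T \<noteq> {}" "b \<in> S" for S T
    proof -
      \<comment> \<open>A cut of \<open>B\<close> is extended to a cut of \<open>W\<close> by adding
        \<open>A\<close> to the part that contains \<open>b\<close>, so the bridge does not cross
        it.\<close>
      have "W = (A \<union> S) \<union> T" "(A \<union> S) \<inter> T = {}" "A \<union> S \<noteq> {}" using that W dis by auto
      then obtain p q where "p \<in> A \<union> S" "q \<in> T" "{p, q} \<in> E"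
        using \<open>conn W\<close> \<open>T \<noteq> {}\<close> unfolding conn_def by metis
      then show ?thesis using cross[of p q] that by blast
    qed
    show "\<exists>p\<in>P. \<exists>q\<in>Q. {p, q} \<in> E"
    proof (cases "b \<in> P")
      case True then show ?thesis using key[of P Q] PQ by blast
    next
      case False
      then have "\<exists>p\<in>Q. \<exists>q\<in>P. {p, q} \<in> E" using key[of Q P] PQ b by blast
      then show ?thesis using edge_sym by blast
    qed
  qed
  ultimately show ?thesis using bridge W br by blast
qed

lemma conn_edge_out:
  assumes "conn W" "A \<subseteq> W" "A \<noteq> {}" "A \<noteq> W"
  obtains a b where "a \<in> A" "b \<in> W - A" "{a, b} \<in> E"
proof -
  have "W = A \<union> (W - A)" "A \<inter> (W - A) = {}" "W - A \<noteq> {}" using assms by auto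
  then have "\<exists>a\<in>A. \<exists>b\<in>W - A. {a, b} \<in> E" using assms unfolding conn_def by metis
  then show ?thesis using that by blast
qed

lemma conn_union:
  assumes A: "conn A" and B: "conn B" and "a \<in> A" "b \<in> B" "{a, b} \<in> E"
  shows "conn (A \<union> B)"
  unfolding conn_def
proof (intro conjI allI impI)
  show "A \<union> B \<noteq> {}" using assms by blast
  fix P Q assume PQ: "A \<union> B = P \<union> Q \<and> P \<inter> Q = {} \<and> P \<noteq> {} \<and> Q \<noteq> {}"
  have key: "\<exists>p\<in>P. \<exists>q\<in>Q. {p, q} \<in> E" if X: "X \<subseteq> P \<union> Q" "conn X" "X \<inter> P \<noteq> {}" "X \<inter> Q \<noteq> {}" for X
  proof -
    have "X \<inter> P \<noteq> X" using that PQ by blast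
    then obtain p q where "p \<in> X \<inter> P" "q \<in> X - X \<inter> P" "{p, q} \<in> E"
      using conn_edge_out[OF X(2), of "X \<inter> P"] X(3) by blast
    then show ?thesis using X by blast
  qed
  consider "A \<inter> P \<noteq> {}" "A \<inter> Q \<noteq> {}" | "B \<inter> P \<noteq> {}" "B \<inter> Q \<noteq> {}"
    | "A \<subseteq> P" "B \<subseteq> Q" | "A \<subseteq> Q" "B \<subseteq> P" using PQ by blast
  then show "\<exists>p\<in>P. \<exists>q\<in>Q. {p, q} \<in> E"
  proof cases
    case 1 then show ?thesis using key[of A] PQ A by blast
  next
    case 2 then show ?thesis using key[of B] PQ B by blast
  next
    case 3 then show ?thesis using assms by blast
  next
    case 4 then show ?thesis using assms edge_sym by blast
  qed
qed

section \<open>The cost of a bridge\<close>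

lemma bridge_sym: "bridge A B a b \<Longrightarrow> bridge B A b a"
  unfolding bridge_def using edge_sym by blast

lemma dd_bridge:
  assumes "finite A" "finite B" "bridge A B a b"
  shows "dd (A - {a}) + dd B \<le> dd (A \<union> B)"
proof -
  have "dd ((A - {a}) \<union> B) = dd (A - {a}) + dd B"
    by (rule dd_add) (use assms in \<open>auto simp: bridge_def\<close>)
  then show ?thesis using dd_mono[of "A \<union> B" "(A - {a}) \<union> B"] assms by fastforce
qed

lemma cycle_weight_bridge:
  assumes "finite A" "finite B" "bridge A B a b"
  shows "cycle_weight (A \<union> B) = cycle_weight A + cycle_weight B"
  by (rule cycle_weight_union[of A B a b]) (use assms in \<open>auto simp: bridge_def\<close>)

lemma card_bridge:
  "finite A \<Longrightarrow> finite B \<Longrightarrow> bridge A B a b \<Longrightarrow> card (A \<union> B) = card A + card B"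
  by (rule card_Un_disjoint) (auto simp: bridge_def)

text \<open>By \<open>dd_remove\<close> the numbers \<open>dd A\<close> and
  \<open>dd (A - {a})\<close> differ by at most \<open>1\<close>, so the bridge costs at most
  \<open>3\<close>, and nothing if some maximum dissociation set of \<open>A\<close> avoids
  \<open>a\<close>.\<close>

lemma bridge_excess_ge:
  assumes "finite A" "finite B" "bridge A B a b"
  shows "excess A + excess B + 3 * int (dd (A - {a})) \<le> excess (A \<union> B) + 3 * int (dd A)"
  using cycle_weight_bridge[OF assms] dd_bridge[OF assms] card_bridge[OF assms]
  by (simp add: excess_def)

text \<open>Otherwise deleting \<open>x\<close> would lower the excess.\<close>

lemma zero_excess_remove:
  assumes "finite A" "x \<in> A" "excess A \<le> 0" "0 \<le> excess (A - {x})"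
  shows "dd (A - {x}) = dd A"
proof (rule ccontr)
  assume "\<not> ?thesis"
  then have "dd (A - {x}) < dd A" using dd_mono[of A "A - {x}"] assms by auto
  moreover have "card A = card (A - {x}) + 1" using assms card_Suc_Diff1 by fastforce
  ultimately show False using cycle_weight_mono[of A "A - {x}"] assms
    by (auto simp: excess_def)
qed

text \<open>On a side of excess \<open>0\<close> the bridge is free, so \<open>B\<close> has at most
  the excess of the union.\<close>

lemma bridge_zero_side:
  assumes fin: "finite A" "finite B" and br: "bridge A B a b"
    and nn: "\<forall>U. U \<subset> A \<union> B \<longrightarrow> 0 \<le> excess U"
    and W: "excess (A \<union> B) \<le> 0" and A: "excess A = 0"
  shows "excess B = 0" "excess (A \<union> B) = 0"
proof -
  have *: "A - {a} \<subset> A \<union> B" "B \<subset> A \<union> B" using br by (auto simp: bridge_def)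
  have "dd (A - {a}) = dd A"
    by (rule zero_excess_remove) (use fin A nn *(1) br in \<open>auto simp: bridge_def\<close>)
  then have "excess B \<le> excess (A \<union> B)" using bridge_excess_ge[OF fin br] A by simp
  then show "excess B = 0" "excess (A \<union> B) = 0" using nn[rule_format, OF *(2)] W by auto
qed

lemma cycle_weight_remove:
  assumes "finite W" "C \<in> cycles W" "x \<in> C"
  shows "cycle_weight (W - {x}) + weight C \<le> cycle_weight W"
proof -
  have "C \<notin> cycles (W - {x})" using assms cycles_sub by blast
  then have "cycle_weight (W - {x}) + weight C = sum weight (insert C (cycles (W - {x})))"
    unfolding cycle_weight_def using assms finite_cycles[of "W - {x}"] by simp
  also have "\<dots> \<le> cycle_weight W" unfolding cycle_weight_def
    by (rule sum_mono2)
      (use assms finite_cycles cycles_mono[of "W - {x}" W] weight_pos in \<open>auto intro: order_trans[OF zero_le_one]\<close>)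
  finally show ?thesis .
qed

section \<open>Bridges in a minimal set of excess at most zero\<close>

definition zero_bridge :: "'a set \<Rightarrow> bool" where
  "zero_bridge W \<longleftrightarrow> (\<exists>A B a b. W = A \<union> B \<and> bridge A B a b \<and> conn A \<and> conn B \<and>
     excess A = 0 \<and> excess B = 0)"

definition pendant_bridges :: "'a set \<Rightarrow> bool" where
  "pendant_bridges W \<longleftrightarrow> (\<forall>A B a b. W = A \<union> B \<and> bridge A B a b \<and> conn A \<and> conn B \<longrightarrow>
     A = {a} \<or> B = {b})"

lemma unit_side:
  assumes fin: "finite A" "finite B" and br: "bridge A B a b" and cA: "conn A" and cB: "conn B"
    and nn: "\<forall>U. U \<subset> A \<union> B \<longrightarrow> 0 \<le> excess U"
    and W: "excess (A \<union> B) \<le> 0" and A: "excess A = 1" and Bpos: "1 \<le> excess B" and ne: "A \<noteq> {a}"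
  shows "zero_bridge (A \<union> B)"
proof -
  have a: "a \<in> A" and dis: "A \<inter> B = {}" and b: "b \<in> B" using br by (auto simp: bridge_def)
  have sub: "A - {a} \<subset> A \<union> B" using br by (auto simp: bridge_def)
  have "dd (A - {a}) \<noteq> dd A" using bridge_excess_ge[OF fin br] A Bpos W by auto
  then have dlt: "dd (A - {a}) < dd A" using dd_mono[of A "A - {a}"] fin by auto
  have cardA: "card A = card (A - {a}) + 1" using fin a card_Suc_Diff1 by fastforce
  \<comment> \<open>The drop of \<open>dd\<close> takes \<open>3\<close> and the deleted vertex
    returns \<open>2\<close>, which uses up the excess \<open>1\<close> exactly. So no cycle weight
    can be lost either, and \<open>a\<close> lies on no cycle of \<open>A\<close>.\<close>
  have eq: "excess (A - {a}) = 0" "cycle_weight (A - {a}) = cycle_weight A"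
    using nn[rule_format, OF sub] dlt cardA A cycle_weight_mono[of A "A - {a}"] fin
    unfolding excess_def by auto
  obtain x where x: "x \<in> A" "{a, x} \<in> E"
    using conn_edge_out[OF cA, of "{a}"] a ne by auto
  show ?thesis
  proof (rule edge_cases[OF cA x(2) a x(1)])
    fix xs assume xs: "cyc_list A E xs" "{a, x} \<in> cyc_edges xs"
    then have "set xs \<in> cycles A" "a \<in> set xs" using cyc_edges_sub[OF xs(2)] by (auto simp: cycles_def)
    then have "cycle_weight (A - {a}) + weight (set xs) \<le> cycle_weight A"
      using cycle_weight_remove fin by blast
    then show ?thesis using eq weight_pos[of "set xs"] by simp
  next
    fix A1 B1 assume s: "A = A1 \<union> B1" "bridge A1 B1 a x" "conn A1" "conn B1"
    have a1: "a \<in> A1" "x \<in> B1" "A1 \<inter> B1 = {}" and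
      cross: "\<And>u v. u \<in> A1 \<Longrightarrow> v \<in> B1 \<Longrightarrow> {u, v} \<in> E \<Longrightarrow> u = a \<and> v = x"
      using s(2) by (auto simp: bridge_def)
    have fin1: "finite A1" "finite B1" using s fin by auto
    have "A - {a} = (A1 - {a}) \<union> B1" using s a1 by auto
    moreover have "excess ((A1 - {a}) \<union> B1) = excess (A1 - {a}) + excess B1"
    proof (rule excess_add)
      show "finite (A1 - {a})" "finite B1" "(A1 - {a}) \<inter> B1 = {}" using fin1 a1 by auto
      show "{u, v} \<notin> E" if "u \<in> A1 - {a}" "v \<in> B1" for u v using cross[of u v] that by blast
    qed
    moreover have "0 \<le> excess (A1 - {a})" "0 \<le> excess B1"
      by (rule nn[rule_format]; use s a1 dis b in auto)+
    ultimately have B1: "excess B1 = 0" using eq by simp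
    \<comment> \<open>\<open>B\<close> is attached to \<open>A\<close> only at \<open>a\<close>,
      which lies in \<open>A1\<close>. So the edge between \<open>x\<close> and \<open>a\<close> is
      also a bridge of the whole set, with \<open>B1\<close> as a side of excess
      \<open>0\<close>.\<close>
    have W': "A \<union> B = B1 \<union> (A1 \<union> B)" using s by auto
    have br': "bridge B1 (A1 \<union> B) x a" unfolding bridge_def
    proof (intro conjI ballI impI)
      show "B1 \<inter> (A1 \<union> B) = {}" using a1 s dis by auto
      show "x \<in> B1" "a \<in> A1 \<union> B" using a1 by auto
      show "{x, a} \<in> E" using x edge_sym by blast
      fix u v assume uv: "u \<in> B1" "v \<in> A1 \<union> B" "{u, v} \<in> E"
      have "v \<notin> B"
      proof
        assume "v \<in> B"
        then have "u = a" using br uv s unfolding bridge_def by blast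
        then show False using uv a1 by blast
      qed
      then have "v \<in> A1" using uv by blast
      moreover have "{v, u} \<in> E" using uv edge_sym by blast
      ultimately show "u = x" "v = a" using cross uv by blast+
    qed
    have "conn (A1 \<union> B)"
      by (rule conn_union[OF s(3) cB a1(1) b]) (use br in \<open>auto simp: bridge_def\<close>)
    moreover have "excess (A1 \<union> B) = 0"
      by (rule bridge_zero_side(1)[OF _ _ br']) (use fin1 fin nn W W' B1 in auto)
    ultimately show ?thesis unfolding zero_bridge_def
      using W' br' s(4) B1 by metis
  qed
qed

lemma excess_le_0_cases:
  assumes fin: "finite W"
    and nn: "\<forall>U. U \<subset> W \<longrightarrow> 0 \<le> excess U" and W: "excess W \<le> 0"
  shows "zero_bridge W \<or> pendant_bridges W"
proof (rule ccontr)
  assume "\<not> ?thesis"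
  then obtain A B a b where s: "W = A \<union> B" "bridge A B a b" "conn A" "conn B" "A \<noteq> {a}" "B \<noteq> {b}"
    and nz: "\<not> zero_bridge W" unfolding pendant_bridges_def by blast
  have f: "finite A" "finite B" using fin s by auto
  have sub: "A \<subset> W" "B \<subset> W" using s by (auto simp: bridge_def)
  have br': "bridge B A b a" and W': "W = B \<union> A" using s bridge_sym by auto
  have nnA: "\<forall>U. U \<subset> A \<union> B \<longrightarrow> 0 \<le> excess U" and nnB: "\<forall>U. U \<subset> B \<union> A \<longrightarrow> 0 \<le> excess U"
    using nn s(1) W' by auto
  have WA: "excess (A \<union> B) \<le> 0" and WB: "excess (B \<union> A) \<le> 0" using W s(1) W' by auto
  have nz': "\<not> (excess A = 0 \<and> excess B = 0)" using nz s(1-4) unfolding zero_bridge_def by metis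
  have "excess A \<noteq> 0" using bridge_zero_side(1)[OF f s(2) nnA WA] nz' by argo
  moreover have "excess B \<noteq> 0" using bridge_zero_side(1)[OF f(2,1) br' nnB WB] nz' by argo
  ultimately have pos: "1 \<le> excess A" "1 \<le> excess B" using nn[rule_format, OF sub(1)] nn[rule_format, OF sub(2)] by linarith+
  have "dd A \<le> dd (A - {a}) + 1" using dd_remove f s by (auto simp: bridge_def)
  then have "int (dd A) \<le> int (dd (A - {a})) + 1" by simp
  then have "excess A + excess B \<le> 3" using bridge_excess_ge[OF f s(2)] WA by linarith
  \<comment> \<open>Two positive integers with sum at most \<open>3\<close> are not both at least
    \<open>2\<close>.\<close>
  then have "excess A = 1 \<or> excess B = 1" using pos by linarith
  then show False
    using unit_side[OF f s(2,3,4) nnA WA _ pos(2) s(5)]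
      unit_side[OF f(2,1) br' s(4,3) nnB WB _ pos(1) s(6)] s(1) W' nz by metis
qed

section \<open>Sets in which every bridge is pendant\<close>

lemma conn_obtain_degree_2:
  assumes "conn W" "finite W" "3 \<le> card W"
  obtains y a b where "y \<in> W" "a \<in> W" "b \<in> W" "a \<noteq> b" "{y, a} \<in> E" "{y, b} \<in> E"
proof -
  obtain p where p: "p \<in> W" using assms by fastforce
  have "W \<noteq> {p}" using assms by auto
  then obtain q where q: "q \<in> W" "q \<noteq> p" "{p, q} \<in> E"
    using conn_edge_out[OF assms(1), of "{p}"] p by auto
  have "W \<noteq> {p, q}" using assms q by auto
  then obtain y r where "y \<in> {p, q}" "r \<in> W - {p, q}" "{y, r} \<in> E"
    using conn_edge_out[OF assms(1), of "{p, q}"] p q by auto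
  then consider "{p, r} \<in> E" "r \<in> W" "r \<noteq> q" | "{q, r} \<in> E" "r \<in> W" "r \<noteq> p" by blast
  then show ?thesis
  proof cases
    case 1 then show ?thesis using that[of p q r] p q by blast
  next
    case 2 then show ?thesis using that[of q p r] p q edge_sym by blast
  qed
qed

text \<open>Every edge is a bridge. A vertex \<open>y\<close> with two neighbours is never a whole
  side, so all its neighbours are leaves and \<open>W\<close> is a star. Deleting the centre leaves
  an independent set, whence the excess is at least \<open>card W - 3\<close>, and only the path
  with three vertices attains \<open>0\<close>.\<close>

lemma pendant_tree:
  assumes W: "W \<subseteq> V" "conn W" and pend: "pendant_bridges W" and acyc: "cycles W = {}"
  shows "0 \<le> excess W" "excess W = 0 \<Longrightarrow> in_C W {e \<in> E. e \<subseteq> W}"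
proof -
  have fin: "finite W" using W finite_sub by blast
  have "0 \<le> excess W \<and> (excess W = 0 \<longrightarrow> in_C W {e \<in> E. e \<subseteq> W})"
  proof (cases "card W \<le> 2")
    case True
    then have "int (card W) \<le> excess W" using excess_dissoc dissoc_card_le_2 fin by blast
    moreover have "card W \<noteq> 0" using W fin by (auto simp: conn_def)
    ultimately show ?thesis by auto
  next
    case False
    then have "3 \<le> card W" by simp
    then obtain y a b where yab: "y \<in> W" "a \<in> W" "b \<in> W" "a \<noteq> b" "{y, a} \<in> E" "{y, b} \<in> E"
      using conn_obtain_degree_2[OF W(2) fin] by blast
    have leaf: "v = y" if w: "w \<in> W" "{y, w} \<in> E" "v \<in> W" "{w, v} \<in> E" for w v
    proof (rule edge_cases[OF W(2) w(2) yab(1) w(1)])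
      fix xs assume "cyc_list W E xs"
      then show ?thesis using acyc by (auto simp: cycles_def)
    next
      fix A B assume s: "W = A \<union> B" "bridge A B y w" "conn A" "conn B"
      have cross: "u = y \<and> v = w" if "u \<in> A" "v \<in> B" "{u, v} \<in> E" for u v
        using s(2) that by (auto simp: bridge_def)
      have "A \<noteq> {y}"
      proof
        assume "A = {y}"
        then have "a \<in> B" "b \<in> B" using s yab edge_neq by blast+
        then show False using cross[of y a] cross[of y b] yab \<open>A = {y}\<close> by blast
      qed
      then have "B = {w}" using pend s unfolding pendant_bridges_def by blast
      then have "v \<in> A" using w s edge_neq by blast
      then show ?thesis using cross[of v w] w s edge_sym \<open>B = {w}\<close> by blast
    qed
    have star: "{y, w} \<in> E" if "w \<in> W" "w \<noteq> y" for w
    proof (rule ccontr)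
      assume neg: "{y, w} \<notin> E"
      let ?N = "insert y {v \<in> W. {y, v} \<in> E}"
      have "?N \<noteq> W" using neg that by blast
      then obtain p q where pq: "p \<in> ?N" "q \<in> W - ?N" "{p, q} \<in> E"
        using conn_edge_out[OF W(2), of ?N] yab(1) by blast
      then show False using leaf[of p q] by blast
    qed
    have indep: "{u, v} \<notin> E" if "u \<in> W - {y}" "v \<in> W - {y}" for u v
      using leaf[of u v] star that by blast
    have "int (card (W - {y})) + excess {} - 2 \<le> excess (insert y ((W - {y}) \<union> {}))"
    proof (rule excess_peel)
      show "dissoc (W - {y})" using indep by (rule dissoc_independent)
    qed (use fin in simp_all)
    moreover have "excess {} \<ge> 0" using excess_dissoc[of "{}"] by (simp add: dissoc_def)
    moreover have "insert y ((W - {y}) \<union> {}) = W" using yab by auto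
    moreover have cW: "card W = card (W - {y}) + 1" using fin yab card_Suc_Diff1 by fastforce
    ultimately have ge: "int (card W) - 3 \<le> excess W" by simp
    moreover have "in_C W {e \<in> E. e \<subseteq> W}" if "excess W = 0"
    proof -
      have c3: "card W = 3" using ge that \<open>3 \<le> card W\<close> by simp
      have ya: "y \<noteq> a" "y \<noteq> b" using yab edge_neq by blast+
      have Weq: "W = {a, y, b}"
        by (rule card_seteq[symmetric]) (use fin yab ya c3 in auto)
      have "{e \<in> E. e \<subseteq> W} = {{a, y}, {y, b}}"
      proof (intro set_eqI iffI)
        fix e assume e: "e \<in> {e \<in> E. e \<subseteq> W}"
        then have "card e = 2" using graph by (auto simp: graph_def)
        then obtain p q where pq: "e = {p, q}" "p \<noteq> q" by (auto simp: card_2_iff)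
        then have "p = y \<or> q = y" using indep[of p q] e by blast
        then show "e \<in> {{a, y}, {y, b}}" using pq e Weq by auto
      next
        fix e assume "e \<in> {{a, y}, {y, b}}"
        then show "e \<in> {e \<in> E. e \<subseteq> W}" using yab edge_sym Weq by auto
      qed
      then have "P3_graph W {e \<in> E. e \<subseteq> W}" unfolding P3_graph_def
        using Weq ya \<open>a \<noteq> b\<close> by (intro exI[of _ a] exI[of _ y] exI[of _ b]) simp
      then show ?thesis by (rule base_P3)
    qed
    ultimately show ?thesis using \<open>3 \<le> card W\<close> by auto
  qed
  then show "0 \<le> excess W" "excess W = 0 \<Longrightarrow> in_C W {e \<in> E. e \<subseteq> W}" by auto
qed

text \<open>A chord together with an arc of the cycle would form a second cycle that meets the
  first.\<close>

lemma cyc_list_induced: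
  assumes xs: "cyc_list V E xs"
  shows "{e \<in> E. e \<subseteq> set xs} = cyc_edges xs"
proof
  show "cyc_edges xs \<subseteq> {e \<in> E. e \<subseteq> set xs}"
    using xs cyc_edges_sub unfolding cyc_list_def by blast
  show "{e \<in> E. e \<subseteq> set xs} \<subseteq> cyc_edges xs"
  proof (rule ccontr)
    assume "\<not> ?thesis"
    then obtain e where e: "e \<in> E" "e \<subseteq> set xs" "e \<notin> cyc_edges xs" by blast
    then have "card e = 2" using graph by (auto simp: graph_def)
    then obtain a b where ab: "e = {a, b}" "a \<noteq> b" by (auto simp: card_2_iff)
    let ?l = "length xs"
    have ne: "xs \<noteq> []" using e ab by auto
    define R where "R = {(x, y). {x, y} \<in> cyc_edges xs}"
    have reach: "(xs ! (i mod ?l), xs ! ((i + k) mod ?l)) \<in> R\<^sup>*" for i k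
    proof (induction k)
      case 0 then show ?case by simp
    next
      case (Suc k)
      have "(xs ! ((i + k) mod ?l), xs ! ((i + Suc k) mod ?l)) \<in> R"
        unfolding R_def cyc_edges_mod[OF ne] by auto
      then show ?case using Suc by simp
    qed
    obtain i j where ij: "i < ?l" "a = xs ! i" "j < ?l" "b = xs ! j"
      using e ab by (metis in_set_conv_nth insert_subset)
    \<comment> \<open>The number of forward steps from position \<open>i\<close> to position
      \<open>j\<close>, with one turn added to stay nonnegative.\<close>
    have "(i + (?l - i + j)) mod ?l = j" using ij by simp
    then have "(a, b) \<in> R\<^sup>*" using reach[of i "?l - i + j"] ij by simp
    moreover have "{x, y} \<in> E \<and> {x, y} \<noteq> {a, b}" if "(x, y) \<in> R" for x y
      using that e ab xs unfolding R_def cyc_list_def by auto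
    moreover have "R \<subseteq> V \<times> V" using xs cyc_edges_sub unfolding R_def cyc_list_def by blast
    ultimately obtain ys where ys: "cyc_list V E ys" "{a, b} \<in> cyc_edges ys"
      using cycle_through_edge[of a b V R] e(1) ab(1) edge_in_V[of a b] by metis
    have "a \<in> set ys" using cyc_edges_sub[OF ys(2)] by auto
    then have "cyc_edges xs = cyc_edges ys" using cyc_list_meet(1)[OF xs ys(1)] e ab by auto
    then show False using ys e ab by simp
  qed
qed

lemma cycles_in_cycle:
  assumes "cyc_list V E xs"
  shows "cycles (set xs) = {set xs}"
proof -
  have xs: "cyc_list (set xs) E xs" using assms by (simp add: cyc_list_def)
  have "C = set xs" if "C \<in> cycles (set xs)" for C
  proof (rule cycles_meet)
    have "set xs \<subseteq> V" using assms by (simp add: cyc_list_def)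
    then show "C \<in> cycles V" using that cycles_mono by blast
    show "set xs \<in> cycles V" using assms by (auto simp: cycles_def)
    show "C \<inter> set xs \<noteq> {}" using cycles_sub[OF that] cycles_card[OF that] by (cases "C = {}") auto
  qed
  then show ?thesis using xs by (auto simp: cycles_def)
qed

text \<open>An edge leaving the cycle lies on no cycle, as this would meet \<open>xs\<close>; so it
  is a bridge. The whole cycle lies on one side, hence the other side is a single vertex.\<close>

lemma pendant_cycle_structure:
  assumes W: "W \<subseteq> V" "conn W" and pend: "pendant_bridges W" and xs: "cyc_list W E xs"
  shows "\<And>w. w \<in> W - set xs \<Longrightarrow> \<exists>u\<in>set xs. {u, w} \<in> E"
    and "\<And>u w v. u \<in> set xs \<Longrightarrow> w \<in> W - set xs \<Longrightarrow> {u, w} \<in> E \<Longrightarrow> v \<in> W \<Longrightarrow> {w, v} \<in> E \<Longrightarrow> v = u"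
proof -
  have xsV: "cyc_list V E xs" using xs W cyc_list_mono by blast
  have sub: "set xs \<subseteq> W" using xs by (simp add: cyc_list_def)
  show leaf: "v = u" if w: "u \<in> set xs" "w \<in> W - set xs" "{u, w} \<in> E" "v \<in> W" "{w, v} \<in> E" for u w v
  proof (rule edge_cases[OF W(2) w(3)])
    show "u \<in> W" "w \<in> W" using w sub by auto
    fix ys assume ys: "cyc_list W E ys" "{u, w} \<in> cyc_edges ys"
    then have "{u, w} \<subseteq> set ys" using cyc_edges_sub by blast
    then have "set xs = set ys"
      using cyc_list_meet(2)[OF xsV cyc_list_mono[OF ys(1) W(1)]] w by blast
    then show ?thesis using w \<open>{u, w} \<subseteq> set ys\<close> by blast
  next
    fix A B assume s: "W = A \<union> B" "bridge A B u w" "conn A" "conn B"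
    have cross: "p = u \<and> q = w" if "p \<in> A" "q \<in> B" "{p, q} \<in> E" for p q
      using s(2) that by (auto simp: bridge_def)
    have "set xs \<subseteq> A \<or> set xs \<subseteq> B"
    proof (rule cycle_not_cross[OF _ _ cross])
      show "cyc_list (A \<union> B) E xs" "A \<inter> B = {}" using s(1,2) xs by (auto simp: bridge_def)
    qed
    then have "set xs \<subseteq> A" using w s by (auto simp: bridge_def)
    have "A \<noteq> {u}"
    proof
      assume "A = {u}"
      then have "card (set xs) \<le> 1" using \<open>set xs \<subseteq> A\<close> card_mono[of "{u}" "set xs"] by simp
      then show False using xs by (simp add: cyc_list_def distinct_card)
    qed
    then have "B = {w}" using pend s unfolding pendant_bridges_def by blast
    then have "v \<in> A" using w s edge_neq by blast
    then show ?thesis using cross[of v w] w s edge_sym \<open>B = {w}\<close> by blast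
  qed
  show "\<exists>u\<in>set xs. {u, w} \<in> E" if w: "w \<in> W - set xs" for w
  proof (rule ccontr)
    assume neg: "\<not> ?thesis"
    let ?N = "set xs \<union> {v \<in> W. \<exists>u\<in>set xs. {u, v} \<in> E}"
    have "?N \<noteq> W" "?N \<subseteq> W" using neg w sub by auto
    moreover have "?N \<noteq> {}" using xs by (auto simp: cyc_list_def)
    ultimately obtain p q where pq: "p \<in> ?N" "q \<in> W - ?N" "{p, q} \<in> E"
      using conn_edge_out[OF W(2), of ?N] by blast
    then show False using leaf[of _ p q] by blast
  qed
qed

end

section \<open>Words of spikes\<close>

text \<open>A word records which vertices of a path carry a spike. In a block word the path with its spikes
  is cut into paths with three vertices: a spike, its vertex and a neighbour, or three consecutive
  vertices without spikes. After a spiked vertex, a gap word makes all further gaps between spikes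
  congruent to \<open>2\<close> and the closing one congruent to \<open>1\<close> modulo \<open>3\<close>.\<close>

fun block_word :: "bool list \<Rightarrow> bool" where
  "block_word [] = True"
| "block_word (True # False # xs) = block_word xs"
| "block_word (False # True # xs) = block_word xs"
| "block_word (False # False # False # xs) = block_word xs"
| "block_word _ = False"

fun gap_word :: "bool list \<Rightarrow> bool" where
  "gap_word [] = True"
| "gap_word (False # True # xs) = gap_word xs"
| "gap_word (False # False # False # xs) = gap_word xs"
| "gap_word _ = False"

section \<open>Comparing block words with gap words\<close>

lemma gap_word_imp_block_word: "gap_word xs \<Longrightarrow> block_word xs"
  by (induction xs rule: gap_word.induct) auto

text \<open>The only block of a block word that a gap word lacks is \<open>True # False\<close>; the
  word is cut at the first such block.\<close>

lemma block_word_split: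
  assumes "block_word xs"
  shows "gap_word xs \<or> (\<exists>w r. xs = w @ True # False # r \<and> gap_word w \<and> block_word r)"
  using assms
proof (induction xs rule: block_word.induct)
  case (2 xs)
  then show ?case by (intro disjI2 exI[of _ "[]"] exI[of _ xs]) simp
next
  case (3 xs)
  then consider "gap_word xs" | w r where "xs = w @ True # False # r" "gap_word w" "block_word r"
    by auto
  then show ?case
  proof cases
    case (2 w r)
    then show ?thesis by (intro disjI2 exI[of _ "False # True # w"] exI[of _ r]) simp
  qed simp
next
  case (4 xs)
  then consider "gap_word xs" | w r where "xs = w @ True # False # r" "gap_word w" "block_word r"
    by auto
  then show ?case
  proof cases
    case (2 w r)
    then show ?thesis by (intro disjI2 exI[of _ "False # False # False # w"] exI[of _ r]) simp
  qed simp
qed auto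

text \<open>Suppose a partition starting at one spike first deviates from a gap word at another spike. The
  partition starting there must be a gap word, since a leading \<open>False\<close> shifts all later blocks.\<close>

lemma block_word_rotate:
  assumes "block_word r" "block_word (False # r @ True # w)" "gap_word w"
  shows "gap_word (False # r @ True # w)"
  using assms by (induction r rule: block_word.induct) auto

text \<open>In a block word a leading spiked vertex is matched with the unspiked vertex after it.
  The first inserted vertex takes over this role, and the old partner completes the other two to a
  block.\<close>

lemma block_word_insert:
  "block_word (True # ys) \<Longrightarrow> block_word (True # False # False # False # ys)"
  by (cases "True # ys" rule: block_word.cases) auto

text \<open>Prepending a spiked vertex shifts the blocks by one place: every spiked vertex is
  matched with its successor instead of its predecessor. Left over at the end is one spiked vertex
  or two unspiked ones.\<close>

lemma gap_word_butlast:
  assumes "gap_word xs" "xs \<noteq> []"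
  shows "if last xs then block_word (True # butlast xs)
    else 2 \<le> length xs \<and> block_word (True # butlast (butlast xs)) \<and> \<not> last (butlast xs)"
  using assms
proof (induction xs rule: gap_word.induct)
  case (2 xs)
  show ?case
  proof (cases "xs = []")
    case False
    then show ?thesis using 2 by (cases xs rule: rev_cases) (auto split: if_splits simp: butlast_append)
  qed simp
next
  case (3 xs)
  show ?case
  proof (cases "xs = []")
    case False
    then have IH: "if last xs then block_word (True # butlast xs)
      else 2 \<le> length xs \<and> block_word (True # butlast (butlast xs)) \<and> \<not> last (butlast xs)"
      using 3 by simp
    show ?thesis
    proof (cases "last xs")
      case True
      then show ?thesis using IH False block_word_insert by auto
    next
      case l: False
      then have "butlast xs \<noteq> []" using IH by (cases xs) auto
      then show ?thesis using IH l False block_word_insert by auto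
    qed
  qed simp
qed auto

text \<open>After a spiked vertex, \<open>n\<close> unspiked ones put the next spike or the end at
  distance \<open>n + 1\<close>. So the residues \<open>1\<close> and \<open>0\<close> are the
  distances \<open>2\<close> and \<open>1\<close> of good spikes.\<close>

lemma gap_word_replicate_aux:
  "(gap_word (replicate n False @ True # w) \<longleftrightarrow> n mod 3 = 1 \<and> gap_word w) \<and>
   (gap_word (replicate n False) \<longleftrightarrow> n mod 3 = 0)"
proof (induction n rule: less_induct)
  case (less n)
  consider "n = 0" | "n = 1" | "n = 2" | k where "n = Suc (Suc (Suc k))"
    by (metis One_nat_def Suc_1 not0_implies_Suc)
  then show ?case
  proof cases
    case (4 k)
    have "n mod 3 = k mod 3" using 4 by presburger
    then show ?thesis using less[of k] 4 by simp
  qed (auto simp: numeral_2_eq_2)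
qed

lemmas gap_word_replicate = gap_word_replicate_aux[THEN conjunct1] gap_word_replicate_aux[THEN conjunct2]

section \<open>Gap words as residues of spike distances\<close>

lemma mod_3_shift:
  fixes k s :: nat
  assumes "s < k" "(k - s) mod 3 = 1"
  shows "(k + 1 - s) mod 3 = 2" "(k + 3 - s) mod 3 = 1"
proof -
  obtain d where "k = s + d" using assms less_imp_add_positive by blast
  then show "(k + 1 - s) mod 3 = 2" "(k + 3 - s) mod 3 = 1" using assms by (auto simp: mod_Suc)
qed

lemma mod_3_pred:
  fixes k s :: nat
  assumes "s < k"
  shows "(k - s) mod 3 = 2 \<Longrightarrow> (k - (s + 1)) mod 3 = 1" "(k - s) mod 3 = 1 \<Longrightarrow> (k - (s + 1)) mod 3 = 0"
proof -
  obtain d where "k = Suc (s + d)" using assms less_imp_Suc_add by blast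
  then show "(k - s) mod 3 = 2 \<Longrightarrow> (k - (s + 1)) mod 3 = 1" "(k - s) mod 3 = 1 \<Longrightarrow> (k - (s + 1)) mod 3 = 0"
    by (auto simp: mod_Suc split: if_splits)
qed

text \<open>The condition on good spikes for an interval whose right end \<open>e\<close> stands for
  the first spike met again after one turn. The wrap-around distance thereby becomes
  \<open>e - i\<close>.\<close>

definition consecutive :: "(nat \<Rightarrow> bool) \<Rightarrow> nat \<Rightarrow> nat \<Rightarrow> bool" where
  "consecutive c s e \<longleftrightarrow>
     (\<forall>i j. s \<le> i \<and> i < j \<and> j < e \<and> c i \<and> c j \<and> (\<forall>t. i < t \<and> t < j \<longrightarrow> \<not> c t) \<longrightarrow> (j - i) mod 3 = 2) \<and>
     (\<forall>i. s \<le> i \<and> i < e \<and> c i \<and> (\<forall>t. i < t \<and> t < e \<longrightarrow> \<not> c t) \<longrightarrow> (e - i) mod 3 = 1)"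

text \<open>\<open>s\<close> is the last spike read so far and \<open>k\<close> the next position to
  be read. The residue of \<open>k - s\<close> says that the reading stands at a block boundary, an
  invariant preserved by both kinds of blocks.\<close>

lemma gap_word_consecutive:
  assumes "gap_word (map c [k..<e])" "k \<le> e" "c s" "s < k" "(k - s) mod 3 = 1"
    "\<And>t. s < t \<Longrightarrow> t < k \<Longrightarrow> \<not> c t"
  shows "consecutive c s e"
  using assms
proof (induction "e - k" arbitrary: k s rule: less_induct)
  case less
  consider "k = e" | "e = k + 1" | "e = k + 2" | "k + 3 \<le> e" using less.prems(2) by linarith
  then show ?case
  proof cases
    case 1
    then have "i = s" if "s \<le> i" "i < e" "c i" for i using less.prems(6)[of i] that by fastforce
    then show ?thesis unfolding consecutive_def using 1 less.prems
      by (metis less_irrefl order_less_le_trans order.strict_implies_order order_trans)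
  next
    case 2 then show ?thesis using less.prems by (cases "c k") auto
  next
    case 3
    then have "[k..<e] = [k, k + 1]" by (simp add: upt_rec)
    then have c: "\<not> c k" "c (k + 1)" using less.prems(1) by (cases "c k"; cases "c (k + 1)"; simp)+
    have e: "e - s = Suc (k + 1 - s)" using 3 less.prems by simp
    have il: "i = s \<or> i = k + 1" if "s \<le> i" "i < e" "c i" for i
      using less.prems(6)[of i] that c 3 by (metis Suc_eq_plus1 add_2_eq_Suc' less_Suc_eq linorder_neqE_nat order_le_less)
    have m: "(k + 1 - s) mod 3 = 2" using mod_3_shift(1) less.prems(4,5) by blast
    show ?thesis unfolding consecutive_def
    proof (intro conjI allI impI)
      fix i j assume "s \<le> i \<and> i < j \<and> j < e \<and> c i \<and> c j \<and> (\<forall>t. i < t \<and> t < j \<longrightarrow> \<not> c t)"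
      then show "(j - i) mod 3 = 2" using il[of i] il[of j] m by auto
    next
      fix i assume i: "s \<le> i \<and> i < e \<and> c i \<and> (\<forall>t. i < t \<and> t < e \<longrightarrow> \<not> c t)"
      then have "i = k + 1" using il[of i] c 3 less.prems by auto
      then show "(e - i) mod 3 = 1" using 3 by simp
    qed
  next
    case 4
    then have up: "[k..<e] = k # (k + 1) # (k + 2) # [k + 3..<e]"
      by (simp add: upt_conv_Cons numeral_3_eq_3)
    have up2: "[k + 2..<e] = (k + 2) # [k + 3..<e]"
      using 4 by (simp add: upt_conv_Cons numeral_3_eq_3)
    show ?thesis
    proof (cases "c (k + 1)")
      case True
      then have c: "\<not> c k" "gap_word (map c [k + 2..<e])"
        using less.prems(1) unfolding up up2 by (cases "c k"; simp)+
      have IH: "consecutive c (k + 1) e"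
        using less.hyps[of "k + 2" "k + 1"] 4 c True by simp
      have m: "(k + 1 - s) mod 3 = 2" using mod_3_shift(1) less.prems(4,5) by blast
      have il: "i = s \<or> k + 1 \<le> i" if "s \<le> i" "c i" for i
        using less.prems(6)[of i] that c
        by (metis Suc_eq_plus1 Suc_leI linorder_neqE_nat order_le_less)
      show ?thesis unfolding consecutive_def
      proof (intro conjI allI impI)
        fix i j assume a: "s \<le> i \<and> i < j \<and> j < e \<and> c i \<and> c j \<and> (\<forall>t. i < t \<and> t < j \<longrightarrow> \<not> c t)"
        show "(j - i) mod 3 = 2"
        proof (cases "i = s")
          case i: True
          then have "k + 1 \<le> j" using il[of j] a by auto
          moreover have "\<not> k + 1 < j" using a True i less.prems by auto
          ultimately show ?thesis using i m by simp
        next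
          case False
          then show ?thesis using il[of i] IH a unfolding consecutive_def by blast
        qed
      next
        fix i assume a: "s \<le> i \<and> i < e \<and> c i \<and> (\<forall>t. i < t \<and> t < e \<longrightarrow> \<not> c t)"
        then have "i \<noteq> s" using True 4 less.prems by auto
        then show "(e - i) mod 3 = 1" using il[of i] IH a unfolding consecutive_def by blast
      qed
    next
      case False
      then have c: "\<not> c k" "\<not> c (k + 2)" "gap_word (map c [k + 3..<e])"
        using less.prems(1) unfolding up by (cases "c k"; cases "c (k + 2)"; simp)+
      have "\<not> c t" if "s < t" "t < k + 3" for t
      proof -
        have "t < k \<or> t = k \<or> t = k + 1 \<or> t = k + 2" using that by linarith
        then show ?thesis using less.prems(6)[of t] that c False by blast
      qed
      moreover have "(k + 3 - s) mod 3 = 1" using mod_3_shift(2) less.prems(4,5) by blast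
      ultimately show ?thesis using less.hyps[of "k + 3" s] 4 c less.prems by simp
    qed
  qed
qed

lemma consecutive_gap_word:
  assumes "consecutive c s e" "c s" "s < e"
  shows "gap_word (map c [s + 1..<e])"
  using assms
proof (induction "e - s" arbitrary: s rule: less_induct)
  case less
  have rep: "map c [s + 1..<j] = replicate (j - (s + 1)) False"
    if "\<And>t. s < t \<Longrightarrow> t < j \<Longrightarrow> \<not> c t" for j
    using that by (intro nth_equalityI) auto
  show ?case
  proof (cases "\<exists>j. s < j \<and> j < e \<and> c j")
    case True
    define j where "j = (LEAST j. s < j \<and> j < e \<and> c j)"
    have j: "s < j" "j < e" "c j" using LeastI_ex[OF True] by (auto simp: j_def)
    have no: "\<not> c t" if "s < t" "t < j" for t
      using not_less_Least[of t "\<lambda>j. s < j \<and> j < e \<and> c j"] that j by (auto simp: j_def)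
    have "(j - s) mod 3 = 2" using less.prems j no unfolding consecutive_def by blast
    then have m: "(j - (s + 1)) mod 3 = 1" using j(1) mod_3_pred(1) by blast
    have "consecutive c j e" unfolding consecutive_def
      using less.prems(1) j(1) unfolding consecutive_def by (meson le_trans less_imp_le_nat)
    then have IH: "gap_word (map c [j + 1..<e])" using less.hyps[of j] j by simp
    have "[s + 1..<e] = [s + 1..<j] @ [j..<e]"
      using j by (metis Suc_eq_plus1 Suc_leI le_add_diff_inverse order_less_imp_le upt_add_eq_append)
    also have "[j..<e] = j # [j + 1..<e]" using j by (simp add: upt_conv_Cons)
    finally have "map c [s + 1..<e] = replicate (j - (s + 1)) False @ True # map c [j + 1..<e]"
      using rep[OF no] j by simp
    then show ?thesis using IH m by (simp add: gap_word_replicate(1))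
  next
    case False
    then have no: "\<not> c t" if "s < t" "t < e" for t using that by blast
    have "(e - s) mod 3 = 1" using less.prems no unfolding consecutive_def by blast
    then have "(e - (s + 1)) mod 3 = 0" using less.prems(3) mod_3_pred(2) by blast
    then show ?thesis using rep[OF no] by (simp add: gap_word_replicate(2))
  qed
qed

section \<open>Spiked cycles\<close>

context cycle_disjoint_graph
begin

lemma dd_triple:
  assumes "finite T" "card T = 3" "{x, y} \<in> E" "{z, y} \<in> E" "x \<noteq> z" "x \<in> T" "y \<in> T" "z \<in> T"
  shows "dd T \<le> 2"
proof (rule ccontr)
  assume "\<not> ?thesis"
  then have "3 \<le> dd T" by simp
  obtain D where D: "D \<subseteq> T" "dissoc D" "card D = dd T" using dd_obtain assms by metis
  then have "D = T" using card_seteq[of T D] assms \<open>3 \<le> dd T\<close> by simp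
  then show False using not_dissoc_path[of D x y z] D assms by blast
qed

lemma card_dissoc_insert:
  assumes "dissoc D" "D \<subseteq> insert x S" "finite S"
  shows "card D \<le> dd S + 1"
proof -
  have f: "finite D" using assms finite_subset by blast
  have "card (D - {x}) \<le> dd S" by (rule dd_ge) (use assms dissoc_mono f in auto)
  moreover have "card D \<le> card (D - {x}) + 1"
    using f diff_card_le_card_Diff[of "{x}" D] by simp
  ultimately show ?thesis by simp
qed

end

text \<open>A cycle vertex may carry any number of pendant vertices here. That it carries at most
  one is deduced from the excess in one direction and assumed in the other.\<close>

locale spiked_cycle = cycle_disjoint_graph +
  fixes W :: "'a set" and us :: "'a list"
  assumes W_sub: "W \<subseteq> V" and us: "cyc_list W E us"
    and attached: "w \<in> W - set us \<Longrightarrow> \<exists>u\<in>set us. {u, w} \<in> E"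
    and leaf: "u \<in> set us \<Longrightarrow> w \<in> W - set us \<Longrightarrow> {u, w} \<in> E \<Longrightarrow> v \<in> W \<Longrightarrow> {w, v} \<in> E \<Longrightarrow> v = u"
begin

text \<open>Positions on the cycle are natural numbers modulo the length, so that a rotation is just a shift.\<close>

abbreviation len :: nat where "len \<equiv> length us"

definition vert :: "nat \<Rightarrow> 'a" where "vert n = us ! (n mod len)"

definition spikes :: "nat \<Rightarrow> 'a set" where "spikes n = {w \<in> W - set us. {vert n, w} \<in> E}"

definition cell :: "nat \<Rightarrow> 'a set" where "cell n = insert (vert n) (spikes n)"

text \<open>A caterpillar: an arc of the cycle with its pendant vertices. The interval may run past
  the length; no cell is repeated as long as \<open>e \<le> s + len\<close>.\<close>

definition seg :: "nat \<Rightarrow> nat \<Rightarrow> 'a set" where "seg s e = \<Union> (cell ` {s..<e})"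

definition word :: "nat \<Rightarrow> nat \<Rightarrow> bool list" where "word s e = map (\<lambda>n. spikes n \<noteq> {}) [s..<e]"

section \<open>Positions, cells and arcs of the cycle\<close>

lemma usV: "cyc_list V E us" using us W_sub cyc_list_mono by blast

lemma len3: "3 \<le> len" and dist: "distinct us" and us_sub: "set us \<subseteq> W"
  using us by (auto simp: cyc_list_def)

lemma us_ne: "us \<noteq> []" using len3 by auto

lemma mod_len: "n mod len < len" using us_ne by simp

lemma finite_W: "finite W" using W_sub finite_sub by blast

lemma vert_in: "vert n \<in> set us" unfolding vert_def using mod_len by simp

lemma vert_eq_iff: "vert m = vert n \<longleftrightarrow> m mod len = n mod len"
  unfolding vert_def using mod_len dist by (simp add: nth_eq_iff_index_eq)

lemma vert_obtain:
  assumes "u \<in> set us"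
  obtains n where "s \<le> n" "n < s + len" "u = vert n"
proof -
  obtain i where i: "i < len" "u = us ! i" using assms by (metis in_set_conv_nth)
  \<comment> \<open>\<open>s - s mod len\<close> is the last multiple of the length not exceeding
    \<open>s\<close>; from there position \<open>i\<close>, or \<open>i\<close> one turn later,
    falls into the window.\<close>
  have m: "(s - s mod len + i) mod len = i" using i(1)
    by (metis dvd_minus_mod dvd_imp_mod_0 mod_add_left_eq add_0 mod_less)
  have "\<exists>n. s \<le> n \<and> n < s + len \<and> n mod len = i"
  proof (cases "s mod len \<le> i")
    case True
    have "s \<le> s - s mod len + i" "s - s mod len + i < s + len"
      using True i(1) mod_less_eq_dividend[of s len] mod_len[of s] by linarith+
    then show ?thesis using m by blast
  next
    case False
    have "(s - s mod len + i + len) mod len = i" using m by simp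
    moreover have "s \<le> s - s mod len + i + len" "s - s mod len + i + len < s + len"
      using False mod_less_eq_dividend[of s len] mod_len[of s] by linarith+
    ultimately show ?thesis by blast
  qed
  then show ?thesis using that i by (auto simp: vert_def)
qed

lemma mod_close:
  assumes "i < j" "j < i + len"
  shows "i mod len \<noteq> j mod len"
proof
  assume "i mod len = j mod len"
  then have "len dvd j - i" using assms mod_eq_dvd_iff_nat[of i j len] by auto
  then show False using assms by (auto dest: dvd_imp_le)
qed

lemma vert_periodic: "vert (n + len) = vert n" by (simp add: vert_def)

lemma spikes_periodic: "spikes (n + len) = spikes n" by (simp add: spikes_def vert_periodic)

lemma finite_spikes: "finite (spikes n)" unfolding spikes_def using finite_W by auto

lemma vert_notin_spikes: "vert m \<notin> spikes n" unfolding spikes_def using vert_in by auto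

lemma spikes_leaf: "w \<in> spikes n \<Longrightarrow> v \<in> W \<Longrightarrow> {w, v} \<in> E \<Longrightarrow> v = vert n"
  unfolding spikes_def using leaf[of "vert n" w v] vert_in by blast

lemma spikes_edge: "w \<in> spikes n \<Longrightarrow> {vert n, w} \<in> E" by (simp add: spikes_def)

lemma cell_sub: "cell n \<subseteq> W" unfolding cell_def spikes_def using vert_in us_sub by auto

lemma card_cell: "card (cell n) = 1 + card (spikes n)"
  unfolding cell_def using vert_notin_spikes finite_spikes by simp

lemma seg_sub: "seg s e \<subseteq> W" unfolding seg_def using cell_sub by blast

lemma finite_seg: "finite (seg s e)" using seg_sub finite_W finite_subset by blast

lemma cell_disjoint:
  assumes "i < j" "j < i + len"
  shows "cell i \<inter> cell j = {}"
proof -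
  have ne: "vert i \<noteq> vert j" using mod_close[OF assms] vert_eq_iff by blast
  have False if "w \<in> spikes i" "w \<in> spikes j" for w
  proof -
    have "{w, vert j} \<in> E" using spikes_edge[OF that(2)] edge_sym by blast
    moreover have "vert j \<in> W" using vert_in us_sub by (rule subsetD[rotated])
    ultimately show False using spikes_leaf[OF that(1)] ne by metis
  qed
  then show ?thesis unfolding cell_def using ne vert_notin_spikes by blast
qed

text \<open>The bound \<open>j + 1 < i + len\<close> excludes position \<open>i + len - 1\<close>,
  which is adjacent to \<open>i\<close> around the cycle. Pendant vertices have no neighbour outside
  their cell, and the cycle has no chords.\<close>

lemma cell_edge:
  assumes "i < j" "j + 1 < i + len" "p \<in> cell i" "q \<in> cell j" "{p, q} \<in> E"
  shows "j = i + 1 \<and> p = vert i \<and> q = vert j"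
proof -
  have dis: "cell i \<inter> cell j = {}" using cell_disjoint assms by simp
  have "p \<notin> spikes i"
  proof
    assume "p \<in> spikes i"
    then have "q = vert i" using spikes_leaf assms cell_sub by blast
    then show False using assms dis by (auto simp: cell_def)
  qed
  then have p: "p = vert i" using assms by (auto simp: cell_def)
  have "q \<notin> spikes j"
  proof
    assume "q \<in> spikes j"
    moreover have "{q, p} \<in> E" using assms edge_sym by blast
    ultimately have "p = vert j" using spikes_leaf assms cell_sub by blast
    then show False using assms dis by (auto simp: cell_def)
  qed
  then have q: "q = vert j" using assms by (auto simp: cell_def)
  have "{p, q} \<in> cyc_edges us"
    using cyc_list_induced[OF usV] assms(5) p q vert_in by blast
  then obtain n where "{vert i, vert j} = {vert n, vert (Suc n)}"
    using p q unfolding cyc_edges_mod[OF us_ne] vert_def by blast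
  then consider "vert i = vert n" "vert j = vert (Suc n)" | "vert j = vert n" "vert i = vert (Suc n)"
    by (auto simp: doubleton_eq_iff)
  then show ?thesis
  proof cases
    case 1
    then have "j mod len = Suc i mod len" by (metis mod_Suc_eq vert_eq_iff)
    then have "j = Suc i" using mod_close[of "Suc i" j] assms by fastforce
    then show ?thesis using p q by simp
  next
    case 2
    then have "(i + len) mod len = Suc j mod len" by (metis mod_Suc_eq vert_eq_iff mod_add_self2)
    then show ?thesis using mod_close[of "Suc j" "i + len"] assms by simp
  qed
qed

lemma seg_split:
  assumes "s \<le> k" "k \<le> e"
  shows "seg s e = seg s k \<union> seg k e"
  unfolding seg_def using ivl_disj_un_two(3)[OF assms] by (metis UN_Un)

lemma seg_single: "seg s (Suc s) = cell s" unfolding seg_def by simp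

lemma seg_empty: "seg s s = {}" unfolding seg_def by simp

lemma seg_disjoint:
  assumes "e \<le> s + len"
  shows "seg s k \<inter> seg k e = {}"
proof -
  have "cell i \<inter> cell j = {}" if "i \<in> {s..<k}" "j \<in> {k..<e}" for i j
    using cell_disjoint[of i j] that assms by auto
  then show ?thesis unfolding seg_def by blast
qed

lemma card_seg_split:
  assumes "s \<le> k" "k \<le> e" "e \<le> s + len"
  shows "card (seg s e) = card (seg s k) + card (seg k e)"
  using seg_split[OF assms(1,2)] seg_disjoint[OF assms(3), of k] finite_seg
  by (simp add: card_Un_disjoint)

lemma seg_full: "seg s (s + len) = W"
proof
  show "W \<subseteq> seg s (s + len)"
  proof
    fix w assume w: "w \<in> W"
    show "w \<in> seg s (s + len)"
    proof (cases "w \<in> set us")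
      case True
      then obtain n where "s \<le> n" "n < s + len" "w = vert n" using vert_obtain by blast
      then show ?thesis unfolding seg_def cell_def by auto
    next
      case False
      then obtain u where u: "u \<in> set us" "{u, w} \<in> E" using attached w by blast
      then obtain n where "s \<le> n" "n < s + len" "u = vert n" using vert_obtain by blast
      then show ?thesis using u False w unfolding seg_def cell_def spikes_def by auto
    qed
  qed
qed (rule seg_sub)

lemma seg_cross:
  assumes "p \<in> seg s k" "q \<in> cell j" "k \<le> j" "j + 1 < s + len" "{p, q} \<in> E"
  shows "j = k \<and> q = vert j"
proof -
  obtain i where i: "s \<le> i" "i < k" "p \<in> cell i" using assms by (auto simp: seg_def)
  then have "j = i + 1 \<and> p = vert i \<and> q = vert j" using cell_edge[of i j p q] assms by simp
  then show ?thesis using i assms by auto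
qed

text \<open>The case of \<open>excess_peel\<close> in which \<open>vert k\<close> is deleted and the
  dissociation set consists of everything before it and its own spikes.\<close>

lemma excess_seg_peel:
  assumes "s \<le> k" "k < e" "e < s + len" "dissoc (seg s k)" "card (spikes k) \<le> 1"
  shows "int (card (seg s k) + card (spikes k)) + excess (seg (Suc k) e) - 2 \<le> excess (seg s e)"
proof -
  have dis1: "seg s k \<inter> cell k = {}" using seg_disjoint[of "Suc k" s k] assms by (simp add: seg_single)
  have dis2: "seg s (Suc k) \<inter> seg (Suc k) e = {}" using seg_disjoint assms by simp
  have s1: "seg s (Suc k) = seg s k \<union> cell k" using seg_split[of s k "Suc k"] assms by (simp add: seg_single)
  have s2: "seg s e = seg s (Suc k) \<union> seg (Suc k) e" using seg_split[of s "Suc k" e] assms(1,2) by simp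
  have v: "vert k \<notin> seg s k \<union> spikes k" "vert k \<notin> seg (Suc k) e"
    using dis1 dis2 s1 vert_notin_spikes by (auto simp: cell_def)
  have eq: "seg s e = insert (vert k) ((seg s k \<union> spikes k) \<union> seg (Suc k) e)"
    using s1 s2 by (auto simp: cell_def)
  have n1: "{p, q} \<notin> E" if "p \<in> seg s k" "q \<in> spikes k" for p q
  proof
    assume "{p, q} \<in> E"
    then have "q = vert k" using seg_cross[of p s k q k] that assms by (auto simp: cell_def)
    then show False using that vert_notin_spikes by blast
  qed
  have n2: "{p, q} \<notin> E" if p: "p \<in> seg s k \<union> spikes k" and q: "q \<in> seg (Suc k) e" for p q
  proof
    assume e: "{p, q} \<in> E"
    obtain j where j: "Suc k \<le> j" "j < e" "q \<in> cell j" using q by (auto simp: seg_def)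
    show False
    proof (cases "p \<in> seg s k")
      case True
      then show False using seg_cross[of p s k q j] j assms e by simp
    next
      case False
      then have "p \<in> spikes k" using p by blast
      then have "p = vert k" using cell_edge[of k j p q] j assms e by (auto simp: cell_def)
      then show False using \<open>p \<in> spikes k\<close> vert_notin_spikes by blast
    qed
  qed
  have "dissoc (spikes k)" using dissoc_card_le_2 finite_spikes assms(5) by simp
  then have d: "dissoc (seg s k \<union> spikes k)" using dissoc_union assms(4) n1 by blast
  have "card (seg s k \<union> spikes k) = card (seg s k) + card (spikes k)"
    by (rule card_Un_disjoint) (use finite_seg finite_spikes dis1 in \<open>auto simp: cell_def\<close>)
  moreover have "int (card (seg s k \<union> spikes k)) + excess (seg (Suc k) e) - 2 \<le> excess (seg s e)"
    unfolding eq
  proof (rule excess_peel[OF _ _ v _ d n2])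
    show "finite (seg s k \<union> spikes k)" "finite (seg (Suc k) e)" using finite_seg finite_spikes by auto
    show "(seg s k \<union> spikes k) \<inter> seg (Suc k) e = {}" using dis2 s1 by (auto simp: cell_def)
  qed
  ultimately show ?thesis by simp
qed

section \<open>Caterpillars and their words\<close>

lemma word_Cons: "s < e \<Longrightarrow> word s e = (spikes s \<noteq> {}) # word (Suc s) e"
  unfolding word_def by (simp add: upt_conv_Cons)

lemma word_empty: "word s s = []" unfolding word_def by simp

lemma card_seg_Suc: "s < e \<Longrightarrow> e \<le> s + len \<Longrightarrow> card (seg s e) = 1 + card (spikes s) + card (seg (Suc s) e)"
  using card_seg_split[of s "Suc s" e] by (simp add: seg_single card_cell)

lemma excess_seg_small:
  "card (seg s e) \<le> 2 \<Longrightarrow> int (card (seg s e)) \<le> excess (seg s e)"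
  using excess_dissoc dissoc_card_le_2 finite_seg by blast

lemma card_spikes:
  assumes "card (spikes n) \<le> 1"
  shows "card (spikes n) = (if spikes n = {} then 0 else 1)"
proof (cases "spikes n = {}")
  case False
  then have "card (spikes n) \<noteq> 0" using finite_spikes by simp
  then show ?thesis using assms False by simp
qed simp

text \<open>Blocks are split off from the left. Deleting an early cycle vertex costs
  \<open>2\<close> but frees a dissociation set with at least two vertices. As the rest has
  nonnegative excess, there are exactly two, and the rest has excess \<open>0\<close> again.\<close>

lemma seg_zero_block_word:
  assumes one: "\<And>n. card (spikes n) \<le> 1" and nn: "\<And>U. U \<subset> W \<Longrightarrow> 0 \<le> excess U"
    and "s \<le> e" "e < s + len" "excess (seg s e) = 0"
  shows "block_word (word s e)"
  using assms(3-5)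
proof (induction "e - s" arbitrary: s rule: less_induct)
  case less
  have tail: "excess (seg (Suc k) e) \<ge> 0" if "s \<le> k" "k < e" for k
  proof (rule nn)
    have "vert k \<in> seg s (Suc k)" using that unfolding seg_def cell_def by auto
    moreover have "seg s (Suc k) \<inter> seg (Suc k) e = {}" using seg_disjoint less.prems by simp
    ultimately have "vert k \<notin> seg (Suc k) e" by blast
    then show "seg (Suc k) e \<subset> W" using seg_sub vert_in us_sub by blast
  qed
  have c1: "card (seg s (Suc s)) = 1 + card (spikes s)" by (simp add: seg_single card_cell)
  have c2: "card (seg s (Suc (Suc s))) = 2 + card (spikes s) + card (spikes (Suc s))"
    using card_seg_split[of s "Suc s" "Suc (Suc s)"] len3 by (simp add: seg_single card_cell)
  have sp: "card (spikes n) = (if spikes n = {} then 0 else 1)" for n using card_spikes one by blast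
  consider "e = s" | "e = Suc s" | "Suc (Suc s) \<le> e" using less.prems by linarith
  then show ?case
  proof cases
    case 1 then show ?thesis by (simp add: word_empty)
  next
    case 2
    then have "1 + card (spikes s) \<le> 2" using one[of s] by simp
    then show ?thesis using excess_seg_small[of s e] 2 c1 less.prems by simp
  next
    case 3
    have d1: "dissoc (seg s (Suc s))"
      using dissoc_card_le_2 finite_seg c1 one[of s] by simp
    have w: "word s e = (spikes s \<noteq> {}) # (spikes (Suc s) \<noteq> {}) # word (Suc (Suc s)) e"
      using 3 by (simp add: word_Cons)
    \<comment> \<open>The second cycle vertex is deleted. Freed are the first one and the spikes of
      both, so in the balanced case exactly one of the two is spiked.\<close>
    have p1: "int (1 + card (spikes s) + card (spikes (Suc s))) + excess (seg (Suc (Suc s)) e) \<le> 2"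
      using excess_seg_peel[of s "Suc s" e] 3 d1 one[of "Suc s"] less.prems c1 by simp
    show ?thesis
    proof (cases "spikes s = {} \<and> spikes (Suc s) = {}")
      case False
      then have "1 + card (spikes s) + card (spikes (Suc s)) \<ge> 2" using sp[of s] sp[of "Suc s"] by auto
      then have z: "excess (seg (Suc (Suc s)) e) = 0" "1 + card (spikes s) + card (spikes (Suc s)) = 2"
        using p1 tail[of "Suc s"] 3 by linarith+
      then have "block_word (word (Suc (Suc s)) e)"
        using less.hyps[of "Suc (Suc s)"] 3 less.prems by simp
      moreover have "(spikes s \<noteq> {}) \<noteq> (spikes (Suc s) \<noteq> {})" 
        using z(2) sp[of s] sp[of "Suc s"] by (cases "spikes s = {}"; cases "spikes (Suc s) = {}") simp_all
      ultimately show ?thesis unfolding w by (cases "spikes s = {}"; cases "spikes (Suc s) = {}") auto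
    next
      case True
      then have cc: "card (seg s (Suc (Suc s))) = 2" using c2 by simp
      have "e \<noteq> Suc (Suc s)" using excess_seg_small[of s e] cc less.prems by auto
      then have e3: "Suc (Suc s) < e" using 3 by simp
      \<comment> \<open>If the first two vertices are unspiked, the third is deleted instead. The
        first two already balance its cost, so it has no spike.\<close>
      have "int (2 + card (spikes (Suc (Suc s)))) + excess (seg (Suc (Suc (Suc s))) e) \<le> 2"
        using excess_seg_peel[of s "Suc (Suc s)" e] dissoc_card_le_2[OF finite_seg] e3
          one[of "Suc (Suc s)"] less.prems cc by simp
      then have z: "excess (seg (Suc (Suc (Suc s))) e) = 0" "card (spikes (Suc (Suc s))) = 0"
        using tail[of "Suc (Suc s)"] e3 by linarith+
      then have "block_word (word (Suc (Suc (Suc s))) e)"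
        using less.hyps[of "Suc (Suc (Suc s))"] e3 less.prems by simp
      then show ?thesis using w z(2) e3 True finite_spikes by (simp add: word_Cons)
    qed
  qed
qed

lemma vert_edge: "{vert n, vert (Suc n)} \<in> E"
proof -
  have "{vert n, vert (Suc n)} \<in> cyc_edges us" unfolding cyc_edges_mod[OF us_ne] vert_def by auto
  then show ?thesis using us by (auto simp: cyc_list_def)
qed

text \<open>Each block spans three vertices containing a path, of which a dissociation set misses
  one; \<open>dd\<close> is subadditive over the blocks.\<close>

lemma block_word_dd:
  assumes one: "\<And>n. card (spikes n) \<le> 1" and "s \<le> e" "e \<le> s + len" "block_word (word s e)"
  shows "3 * dd (seg s e) \<le> 2 * card (seg s e)"
  using assms(2-4)
proof (induction "e - s" arbitrary: s rule: less_induct)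
  case less
  have sp: "card (spikes n) = (if spikes n = {} then 0 else 1)" for n using card_spikes one by blast
  have step: ?case if k: "s < k" "k \<le> e" "dd (seg s k) \<le> 2" "card (seg s k) = 3" "block_word (word k e)" for k
  proof -
    have "3 * dd (seg k e) \<le> 2 * card (seg k e)" using less.hyps[of k] k less.prems by simp
    moreover have "dd (seg s e) \<le> dd (seg s k) + dd (seg k e)"
      using seg_split[of s k e] k dd_subadd finite_seg by simp
    moreover have "card (seg s e) = 3 + card (seg k e)" using card_seg_split[of s k e] k less.prems by simp
    ultimately show ?thesis using k by linarith
  qed
  have in_seg: "vert i \<in> seg s k" "spikes i \<subseteq> seg s k" if "s \<le> i" "i < k" for i k
    using that unfolding seg_def cell_def by auto
  have c2: "card (seg s (Suc (Suc s))) = 2 + card (spikes s) + card (spikes (Suc s))"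
    using card_seg_split[of s "Suc s" "Suc (Suc s)"] len3 by (simp add: seg_single card_cell)
  have c3: "card (seg s (Suc (Suc (Suc s)))) = 3 + card (spikes s) + card (spikes (Suc s)) + card (spikes (Suc (Suc s)))"
    using card_seg_split[of s "Suc (Suc s)" "Suc (Suc (Suc s))"] len3 c2 by (simp add: seg_single card_cell)
  consider "e = s" | "e = Suc s" | "Suc (Suc s) \<le> e" using less.prems by linarith
  then show ?case
  proof cases
    case 1
    then show ?thesis using dd_le_card[of "{}"] by (simp add: seg_empty)
  next
    case 2
    then show ?thesis using less.prems(3) by (cases "spikes s = {}") (simp_all add: word_Cons word_empty)
  next
    case 3
    have w: "word s e = (spikes s \<noteq> {}) # (spikes (Suc s) \<noteq> {}) # word (Suc (Suc s)) e"
      using 3 by (simp add: word_Cons)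
    consider "spikes s \<noteq> {}" "spikes (Suc s) = {}" "block_word (word (Suc (Suc s)) e)"
      | "spikes s = {}" "spikes (Suc s) \<noteq> {}" "block_word (word (Suc (Suc s)) e)"
      | "spikes s = {}" "spikes (Suc s) = {}"
      using less.prems(3) unfolding w by (cases "spikes s = {}"; cases "spikes (Suc s) = {}") auto
    then show ?thesis
    proof cases
      case 1
      then obtain x where x: "x \<in> spikes s" by blast
      have card: "card (seg s (Suc (Suc s))) = 3" using c2 sp[of s] 1(1,2) by simp
      have "dd (seg s (Suc (Suc s))) \<le> 2"
      proof (rule dd_triple[OF finite_seg card])
        show "{x, vert s} \<in> E" "{vert (Suc s), vert s} \<in> E"
          using spikes_edge[OF x] vert_edge[of s] edge_sym by blast+
        show "x \<noteq> vert (Suc s)" using x vert_notin_spikes by blast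
        show "x \<in> seg s (Suc (Suc s))" using in_seg(2)[of s "Suc (Suc s)"] x by auto
      qed (use in_seg in auto)
      then show ?thesis using step[OF _ 3 _ card 1(3)] by simp
    next
      case 2
      then obtain x where x: "x \<in> spikes (Suc s)" by blast
      have card: "card (seg s (Suc (Suc s))) = 3" using c2 sp[of "Suc s"] 2(1,2) by simp
      have "dd (seg s (Suc (Suc s))) \<le> 2"
      proof (rule dd_triple[OF finite_seg card])
        show "{x, vert (Suc s)} \<in> E" "{vert s, vert (Suc s)} \<in> E"
          using spikes_edge[OF x] vert_edge[of s] edge_sym by blast+
        show "x \<noteq> vert s" using x vert_notin_spikes by blast
        show "x \<in> seg s (Suc (Suc s))" using in_seg[of "Suc s" "Suc (Suc s)"] x by auto
      qed (use in_seg in auto)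
      then show ?thesis using step[OF _ 3 _ card 2(3)] by simp
    next
      case b: 3
      have "e \<noteq> Suc (Suc s)" using less.prems(3) w b by (auto simp: word_empty)
      then have e3: "Suc (Suc s) < e" using 3 by simp
      then have b3: "spikes (Suc (Suc s)) = {}" "block_word (word (Suc (Suc (Suc s))) e)"
        using less.prems(3) w b by (cases "spikes (Suc (Suc s)) = {}"; simp add: word_Cons)+
      have card: "card (seg s (Suc (Suc (Suc s)))) = 3" using c3 b b3(1) by simp
      have "dd (seg s (Suc (Suc (Suc s)))) \<le> 2"
      proof (rule dd_triple[OF finite_seg card])
        show "{vert s, vert (Suc s)} \<in> E" "{vert (Suc (Suc s)), vert (Suc s)} \<in> E"
          using vert_edge[of s] vert_edge[of "Suc s"] edge_sym by blast+
        show "vert s \<noteq> vert (Suc (Suc s))" using vert_eq_iff mod_close[of s "Suc (Suc s)"] len3 by simp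
      qed (use in_seg in auto)
      then show ?thesis using step[OF _ _ _ card b3(2)] e3 by simp
    qed
  qed
qed

text \<open>A pendant vertex is adjacent only to its cycle vertex, so every edge in
  \<open>W\<close>, and hence every cycle, meets \<open>us\<close>.\<close>

lemma cycles_W: "cycles W = {set us}"
proof -
  have "C = set us" if C: "C \<in> cycles W" for C
  proof (rule cycles_meet)
    show "C \<in> cycles V" using C cycles_mono W_sub by blast
    show "set us \<in> cycles V" using usV by (auto simp: cycles_def)
    obtain xs where xs: "C = set xs" "cyc_list W E xs" using C by (auto simp: cycles_def)
    have ne: "xs \<noteq> []" using xs by (auto simp: cyc_list_def)
    then have "{xs ! (0 mod length xs), xs ! (Suc 0 mod length xs)} \<in> cyc_edges xs"
      using cyc_edges_mod by blast
    then obtain p q where pq: "{p, q} \<in> E" "p \<in> C" "q \<in> C"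
      using xs cyc_edges_sub unfolding cyc_list_def by blast
    have "p \<in> set us \<or> q \<in> set us"
    proof (rule ccontr)
      assume neg: "\<not> ?thesis"
      then obtain u where "u \<in> set us" "{u, p} \<in> E" using attached[of p] pq cycles_sub[OF C] by blast
      then show False using leaf[of u p q] pq cycles_sub[OF C] neg by blast
    qed
    then show "C \<inter> set us \<noteq> {}" using pq by blast
  qed
  then show ?thesis using us by (auto simp: cycles_def)
qed

section \<open>Deleting a cycle vertex\<close>

lemma cycle_weight_W: "cycle_weight W = (if len mod 3 = 1 then 2 else 1)"
  unfolding cycle_weight_def cycles_W using dist by (simp add: weight_def distinct_card)

text \<open>Deleting \<open>vert n\<close> isolates its spikes, which then contribute at least
  \<open>1\<close> each, opens the cycle into a caterpillar and loses the whole cycle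
  weight.\<close>

lemma excess_remove_vert:
  "excess (seg (Suc n) (n + len)) + int (card (spikes n)) - 2 + cycle_weight W \<le> excess W"
proof -
  have v: "vert n \<in> W" using vert_in us_sub by blast
  have dis: "seg n (Suc n) \<inter> seg (Suc n) (n + len) = {}" using seg_disjoint by simp
  have full: "W = cell n \<union> seg (Suc n) (n + len)"
    using seg_full[of n] seg_split[of n "Suc n" "n + len"] len3 by (simp add: seg_single)
  have eq: "W - {vert n} = spikes n \<union> seg (Suc n) (n + len)"
    using full dis vert_notin_spikes[of n n] by (auto simp: cell_def seg_single)
  have "excess (spikes n \<union> seg (Suc n) (n + len)) = excess (spikes n) + excess (seg (Suc n) (n + len))"
  proof (rule excess_add)
    show "spikes n \<inter> seg (Suc n) (n + len) = {}" using dis by (auto simp: cell_def seg_single)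
    show "{u, v} \<notin> E" if "u \<in> spikes n" "v \<in> seg (Suc n) (n + len)" for u v
    proof
      assume "{u, v} \<in> E"
      then have "v = vert n" using spikes_leaf[of u n v] that seg_sub by blast
      then show False using that eq v by blast
    qed
  qed (simp_all add: finite_spikes finite_seg)
  moreover have "dissoc (spikes n)"
  proof (rule dissoc_independent)
    fix u v assume uv: "u \<in> spikes n" "v \<in> spikes n"
    show "{u, v} \<notin> E"
    proof
      assume "{u, v} \<in> E"
      then have "v = vert n" using spikes_leaf[of u n v] uv by (auto simp: spikes_def)
      then show False using uv vert_notin_spikes by blast
    qed
  qed
  then have "int (card (spikes n)) \<le> excess (spikes n)" using excess_dissoc finite_spikes by blast
  moreover have "cycles (W - {vert n}) = {}"
  proof -
    have "set us \<notin> cycles (W - {vert n})"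
      using cycles_sub[of "set us" "W - {vert n}"] vert_in[of n] by auto
    moreover have "cycles (W - {vert n}) \<subseteq> {set us}"
      using cycles_mono[of "W - {vert n}" W] cycles_W by auto
    ultimately show ?thesis by auto
  qed
  then have "cycle_weight (W - {vert n}) = 0" by (simp add: cycle_weight_def)
  ultimately show ?thesis using excess_remove_le[OF finite_W v] eq by simp
qed

lemma card_W: "card W = 1 + card (spikes n) + card (seg (Suc n) (n + len))"
  using card_seg_Suc[of n "n + len"] seg_full[of n] us_ne by simp

section \<open>Choice of the starting spike\<close>

lemma word_append: "s \<le> k \<Longrightarrow> k \<le> e \<Longrightarrow> word s e = word s k @ word k e"
  unfolding word_def by (metis le_add_diff_inverse map_append upt_add_eq_append)

lemma word_shift: "word (s + len) (e + len) = word s e"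
proof -
  have "spikes (s + len + i) = spikes (s + i)" for i
    using spikes_periodic[of "s + i"] by (metis add.assoc add.commute)
  then show ?thesis unfolding word_def by (intro nth_equalityI) simp_all
qed

lemma length_word: "length (word s e) = e - s" by (simp add: word_def)

text \<open>One change of the starting spike suffices. If the word from \<open>n\<close> is
  \<open>w @ True # False # r\<close>, then the word from the spike at the displayed
  \<open>True\<close> is \<open>False # r @ True # w\<close>, and it is a block word by assumption
  as well.\<close>

lemma rotation_gap_word:
  assumes block: "\<And>n. spikes n \<noteq> {} \<Longrightarrow> block_word (word (Suc n) (n + len))"
    and n: "spikes n \<noteq> {}"
  shows "\<exists>m. spikes m \<noteq> {} \<and> gap_word (word (Suc m) (m + len))"
proof (cases "gap_word (word (Suc n) (n + len))")
  case True then show ?thesis using n by blast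
next
  case False
  then obtain w r where wr: "word (Suc n) (n + len) = w @ True # False # r" "gap_word w" "block_word r"
    using block_word_split[OF block[OF n]] by blast
  define m where "m = Suc n + length w"
  have L: "length w + 2 + length r = len - 1"
    using arg_cong[OF wr(1), of length] by (simp add: length_word)
  then have le: "Suc (Suc m) \<le> n + len" unfolding m_def by simp
  have split: "word (Suc n) (n + len) = word (Suc n) m @ word m (n + len)"
    by (rule word_append) (use le in \<open>simp_all add: m_def\<close>)
  have "length (word (Suc n) m) = length w" by (simp add: length_word m_def)
  then have w: "word (Suc n) m = w" and tl: "word m (n + len) = True # False # r"
    using split wr(1) by auto
  have m: "spikes m \<noteq> {}" "word (Suc m) (n + len) = False # r"
    using tl le by (simp_all add: word_Cons)
  have "word (n + len) (m + len) = word n m" by (rule word_shift)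
  also have "\<dots> = True # w" using n w by (simp add: word_Cons m_def)
  finally have "word (Suc m) (m + len) = False # r @ True # w"
    using word_append[of "Suc m" "n + len" "m + len"] le m(2) by (simp add: m_def)
  then show ?thesis using block_word_rotate[OF wr(3) _ wr(2)] block[OF m(1)] m(1) by metis
qed

lemma edge_W_cases:
  assumes "e \<in> E" "e \<subseteq> W"
  obtains (cycle) "e \<in> cyc_edges us" | (spike) n w where "w \<in> spikes n" "e = {vert n, w}"
proof -
  have "card e = 2" using graph assms by (auto simp: graph_def)
  then obtain p q where pq: "e = {p, q}" by (auto simp: card_2_iff)
  have spk: thesis if "e = {p, q}" "p \<notin> set us" for p q
  proof -
    have p: "p \<in> W - set us" using that assms by blast
    then obtain u where u: "u \<in> set us" "{u, p} \<in> E" using attached by blast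
    then have "q = u" using leaf[of u p q] p that assms by blast
    moreover obtain n where "u = vert n" using vert_obtain[OF u(1), of 0] by blast
    ultimately show thesis using spike[of p n] p u that by (auto simp: spikes_def insert_commute)
  qed
  show thesis
  proof (cases "p \<in> set us \<and> q \<in> set us")
    case True
    then show thesis using cycle cyc_list_induced[OF usV] assms pq by blast
  next
    case False
    then show thesis using spk[of p q] spk[of q p] pq by (auto simp: insert_commute)
  qed
qed

text \<open>The cycle is relabelled to start at the spiked vertex \<open>m\<close>, so that
  \<open>Min I = 0\<close> and the wrap-around distance is \<open>len - Max I\<close>.\<close>

lemma gap_word_very_good:
  assumes one: "\<And>n. card (spikes n) \<le> 1" and len: "len mod 3 \<noteq> 1"
    and m: "spikes m \<noteq> {}" "gap_word (word (Suc m) (m + len))"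
  shows "very_good_spiked_cycle W {e \<in> E. e \<subseteq> W}"
proof -
  define vs where "vs = map (\<lambda>j. vert (m + j)) [0..<len]"
  define c where "c = (\<lambda>j. spikes (m + j) \<noteq> {})"
  define I where "I = {j. j < len \<and> c j}"
  define w where "w = (\<lambda>j. SOME x. x \<in> spikes (m + j))"
  have lvs: "length vs = len" by (simp add: vs_def)
  have vs_nth: "vs ! j = vert (m + j)" if "j < len" for j using that by (simp add: vs_def)
  have dvs: "distinct vs"
  proof -
    have "inj_on (\<lambda>j. vert (m + j)) {0..<len}"
    proof (rule linorder_inj_onI)
      fix i j assume "i < j" "i \<in> {0..<len}" "j \<in> {0..<len}"
      then show "vert (m + i) \<noteq> vert (m + j)" using mod_close[of "m + i" "m + j"] vert_eq_iff by simp
    qed auto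
    then show ?thesis by (simp add: vs_def distinct_map)
  qed
  have svs: "set vs = set us"
  proof
    show "set vs \<subseteq> set us" unfolding vs_def using vert_in by auto
    show "set us \<subseteq> set vs"
    proof
      fix u assume "u \<in> set us"
      then obtain n where n: "m \<le> n" "n < m + len" "u = vert n" using vert_obtain by blast
      then have "vs ! (n - m) = u" "n - m < length vs" using vs_nth[of "n - m"] lvs by auto
      then show "u \<in> set vs" using nth_mem by blast
    qed
  qed
  have "cyc_edges vs \<subseteq> E"
  proof
    fix e assume "e \<in> cyc_edges vs"
    then obtain i where i: "i < len" "e = {vs ! i, vs ! ((i + 1) mod len)}"
      by (auto simp: cyc_edges_def lvs)
    have "vs ! ((i + 1) mod len) = vert (m + (i + 1) mod len)" using vs_nth mod_len by simp
    also have "\<dots> = vert (Suc (m + i))" unfolding vert_eq_iff by (simp add: mod_add_right_eq)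
    finally show "e \<in> E" using i vs_nth[of i] vert_edge[of "m + i"] by simp
  qed
  then have cvs: "cyc_list V E vs"
    unfolding cyc_list_def using lvs len3 dvs svs us_sub W_sub by auto
  have cev: "cyc_edges vs = cyc_edges us"
    using cyc_list_induced[OF cvs] cyc_list_induced[OF usV] svs by simp
  have sing: "spikes (m + j) = {w j}" if "j \<in> I" for j
  proof -
    have "w j \<in> spikes (m + j)" using that unfolding I_def c_def w_def by (auto intro: someI_ex)
    then show ?thesis using one[of "m + j"] finite_spikes[of "m + j"]
      by (metis One_nat_def card_le_Suc0_iff_eq is_singletonI' is_singleton_def singletonD empty_iff insert_iff)
  qed
  have I0: "0 \<in> I" using m(1) us_ne by (simp add: I_def c_def)
  have finI: "finite I" by (simp add: I_def)
  have inj: "inj_on w I"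
  proof (rule linorder_inj_onI)
    fix i j assume ij: "i < j" "i \<in> I" "j \<in> I"
    then have "cell (m + i) \<inter> cell (m + j) = {}" using cell_disjoint by (simp add: I_def)
    then show "w i \<noteq> w j" using sing[OF ij(2)] sing[OF ij(3)] by (auto simp: cell_def)
  qed auto
  have Weq: "W = set vs \<union> w ` I"
  proof
    show "set vs \<union> w ` I \<subseteq> W" using svs us_sub sing by (auto simp: spikes_def)
    show "W \<subseteq> set vs \<union> w ` I"
    proof
      fix x assume x: "x \<in> W"
      then have "x \<in> seg m (m + len)" by (simp add: seg_full)
      then obtain n where n: "m \<le> n" "n < m + len" "x \<in> cell n" by (auto simp: seg_def)
      show "x \<in> set vs \<union> w ` I"
      proof (cases "x \<in> set us")
        case True then show ?thesis using svs by simp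
      next
        case False
        then have xs: "x \<in> spikes (m + (n - m))" using n vert_in by (auto simp: cell_def)
        moreover have "n - m \<in> I" using xs n by (auto simp: I_def c_def)
        ultimately show ?thesis using sing by blast
      qed
    qed
  qed
  have dis: "w ` I \<inter> set vs = {}" using sing svs by (fastforce simp: spikes_def)
  have Eeq: "{e \<in> E. e \<subseteq> W} = cyc_edges vs \<union> {{vs ! i, w i} | i. i \<in> I}"
  proof (intro set_eqI iffI)
    fix e assume "e \<in> {e \<in> E. e \<subseteq> W}"
    then have e: "e \<in> E" "e \<subseteq> W" by auto
    show "e \<in> cyc_edges vs \<union> {{vs ! i, w i} | i. i \<in> I}"
    proof (rule edge_W_cases[OF e])
      assume "e \<in> cyc_edges us" then show ?thesis using cev by simp
    next
      fix n x assume nx: "x \<in> spikes n" "e = {vert n, x}"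
      obtain k where k: "m \<le> k" "k < m + len" "vert n = vert k" using vert_obtain[OF vert_in] by blast
      then have "x \<in> spikes (m + (k - m))" using nx by (simp add: spikes_def)
      moreover have kI: "k - m \<in> I" using calculation k by (auto simp: I_def c_def)
      ultimately have "x = w (k - m)" using sing by blast
      moreover have "vs ! (k - m) = vert n" using k vs_nth[of "k - m"] by simp
      ultimately have "e = {vs ! (k - m), w (k - m)}" using nx by simp
      then show ?thesis using kI by blast
    qed
  next
    fix e assume "e \<in> cyc_edges vs \<union> {{vs ! i, w i} | i. i \<in> I}"
    then show "e \<in> {e \<in> E. e \<subseteq> W}"
    proof
      assume "e \<in> cyc_edges vs"
      then show ?thesis using cyc_list_induced[OF cvs] svs us_sub by blast
    next
      assume "e \<in> {{vs ! i, w i} | i. i \<in> I}"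
      then obtain i where i: "i \<in> I" "e = {vs ! i, w i}" by blast
      then have "w i \<in> spikes (m + i)" using sing by blast
      then have "{vert (m + i), w i} \<in> E" "w i \<in> W" by (auto simp: spikes_def)
      then show ?thesis using i vs_nth[of i] vert_in us_sub by (auto simp: I_def)
    qed
  qed
  have "map c [1..<len] = word (Suc m) (m + len)"
    unfolding word_def c_def by (rule nth_equalityI) auto
  then have cons: "consecutive c 0 len"
    using gap_word_consecutive[of c 1 len 0] m len3 I0 by (auto simp: I_def)
  \<comment> \<open>A single spike would be at distance \<open>len\<close> from its own next
    occurrence, so the length would be \<open>1\<close> modulo \<open>3\<close>.\<close>
  have "\<exists>j. 0 < j \<and> j < len \<and> c j"
  proof (rule ccontr)
    assume "\<not> ?thesis"
    then have "(len - 0) mod 3 = 1" using cons I0 unfolding consecutive_def I_def by blast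
    then show False using len by simp
  qed
  then obtain j where j: "j \<in> I" "j \<noteq> 0" by (auto simp: I_def)
  have "card {0, j} \<le> card I" by (rule card_mono) (use finI I0 j in auto)
  then have two: "2 \<le> card I" using j by simp
  have Min: "Min I = 0" using I0 finI by (metis Min_le le_zero_eq)
  have Max: "Max I \<in> I" using finI I0 by (metis Max_in empty_iff)
  have later: "\<not> c t" if "Max I < t" "t < len" for t
  proof
    assume "c t"
    then have "t \<in> I" using that by (simp add: I_def)
    then show False using Max_ge[OF finI] that by fastforce
  qed
  have "(len - Max I) mod 3 = 1" using cons Max later unfolding consecutive_def I_def by blast
  moreover have "(j - i) mod 3 = 2"
    if "i \<in> I" "j \<in> I" "i < j" "\<forall>t\<in>I. \<not> (i < t \<and> t < j)" for i j
  proof -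
    have "\<not> c t" if "i < t" "t < j" for t
      using \<open>\<forall>t\<in>I. \<not> (i < t \<and> t < j)\<close> that \<open>j \<in> I\<close> unfolding I_def
      by (metis (mono_tags, lifting) less_trans mem_Collect_eq)
    then have "0 \<le> i \<and> i < j \<and> j < len \<and> c i \<and> c j \<and> (\<forall>t. i < t \<and> t < j \<longrightarrow> \<not> c t)"
      using that(1-3) by (simp add: I_def)
    then show ?thesis using cons[unfolded consecutive_def, THEN conjunct1] by blast
  qed
  ultimately have "good_spikes len I" unfolding good_spikes_def using two Min by auto
  then have "very_good_spikes (length vs) I" using len lvs by (simp add: very_good_spikes_def)
  then show ?thesis unfolding very_good_spiked_cycle_def
    using lvs len3 dvs I0 inj dis Weq Eeq
    by (intro exI[of _ vs] exI[of _ I] exI[of _ w]) (auto simp: I_def)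
qed

section \<open>Classification of cycles with pendant vertices\<close>

lemma no_spikes_W:
  assumes "\<And>n. spikes n = {}"
  shows "W = set us"
proof
  show "W \<subseteq> set us"
    using seg_full[of 0] assms vert_in by (auto simp: seg_def cell_def)
qed (rule us_sub)

lemma no_spikes_cycle_graph:
  assumes "\<And>n. spikes n = {}"
  shows "cycle_graph W {e \<in> E. e \<subseteq> W} len"
  unfolding cycle_graph_def no_spikes_W[OF assms] cyc_list_induced[OF usV]
  using len3 dist by blast

lemma spiked_cycle_classify:
  assumes nn: "\<And>U. U \<subset> W \<Longrightarrow> 0 \<le> excess U" and W: "excess W \<le> 0"
  shows "excess W = 0 \<and> in_C W {e \<in> E. e \<subseteq> W}"
proof -
  have rest: "0 \<le> excess (seg (Suc n) (n + len))" for n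
  proof (rule nn)
    have "seg n (Suc n) \<inter> seg (Suc n) (n + len) = {}" using seg_disjoint by simp
    then have "vert n \<notin> seg (Suc n) (n + len)" by (auto simp: seg_single cell_def)
    moreover have "vert n \<in> W" using vert_in us_sub by blast
    ultimately show "seg (Suc n) (n + len) \<subset> W" using seg_sub by blast
  qed
  show ?thesis
  proof (cases "len mod 3 = 1")
    case True
    \<comment> \<open>The cycle weight \<open>2\<close> pays for the deleted vertex, so any spike
      would make the excess positive.\<close>
    then have "excess (seg (Suc n) (n + len)) + int (card (spikes n)) \<le> excess W" for n
      using excess_remove_vert[of n] cycle_weight_W by simp
    then have *: "excess (seg (Suc n) (n + len)) + int (card (spikes n)) \<le> excess W" "card (spikes n) = 0" for n
      using rest[of n] W by (smt (verit) of_nat_0_le_iff of_nat_0_eq_iff)+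
    then have "\<And>n. spikes n = {}" using finite_spikes by simp
    then show ?thesis using base_cycle[OF no_spikes_cycle_graph] True *(1)[of 0] rest[of 0] W by simp
  next
    case False
    \<comment> \<open>The cycle weight \<open>1\<close> leaves a cost of \<open>1\<close>. So at
      most one spike fits at each vertex, and where there is one, the remaining caterpillar has
      excess \<open>0\<close>.\<close>
    then have ineq: "excess (seg (Suc n) (n + len)) + int (card (spikes n)) - 1 \<le> excess W" for n
      using excess_remove_vert[of n] cycle_weight_W by simp
    have one: "card (spikes n) \<le> 1" for n using ineq[of n] rest[of n] W by linarith
    show ?thesis
    proof (cases "\<exists>n. spikes n \<noteq> {}")
      case True
      then obtain n where n: "spikes n \<noteq> {}" by blast
      have c1: "card (spikes k) = 1" if "spikes k \<noteq> {}" for k using card_spikes[OF one] that by simp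
      have zero: "excess W = 0" using ineq[of n] rest[of n] c1[OF n] W by simp
      have "block_word (word (Suc k) (k + len))" if "spikes k \<noteq> {}" for k
      proof (rule seg_zero_block_word[OF one nn])
        show "excess (seg (Suc k) (k + len)) = 0" using ineq[of k] rest[of k] c1[OF that] zero by simp
        show "Suc k \<le> k + len" "k + len < Suc k + len" using us_ne by (simp_all add: Suc_leI)
      qed
      then obtain m where "spikes m \<noteq> {}" "gap_word (word (Suc m) (m + len))"
        using rotation_gap_word[OF _ n] by blast
      then show ?thesis using zero base_spiked gap_word_very_good[OF one False] by blast
    next
      case no: False
      then have none: "\<And>n. spikes n = {}" by blast
      have card: "card W = len" using no_spikes_W[OF none] dist by (simp add: distinct_card)
      have ge: "-1 \<le> excess W" using ineq[of 0] rest[of 0] by simp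
      have ex: "excess W = 3 * int (dd W) + 1 - 2 * int len"
        unfolding excess_def using cycle_weight_W False card by simp
      \<comment> \<open>Modulo \<open>3\<close> the excess is \<open>len + 1\<close>, and its value
        is \<open>-1\<close> or \<open>0\<close>. Length \<open>0\<close> would give the residue
        \<open>1\<close>; length \<open>2\<close> gives the value \<open>0\<close>.\<close>
      have "excess W = 0 \<and> len mod 3 \<noteq> 0" using ex ge W False by presburger
      then have "excess W = 0" "len mod 3 \<noteq> 0" by blast+
      then show ?thesis using base_cycle[OF no_spikes_cycle_graph[OF none]] by blast
    qed
  qed
qed

section \<open>Upper bounds for cycles and very good spiked cycles\<close>

lemma gap_word_excess:
  assumes one: "\<And>n. card (spikes n) \<le> 1" and len: "len mod 3 \<noteq> 1"
    and n: "spikes n \<noteq> {}" "gap_word (word (Suc n) (n + len))"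
  shows "excess W \<le> 0"
proof -
  obtain D where D: "D \<subseteq> W" "dissoc D" "card D = dd W" using dd_obtain[OF finite_W] by metis
  have finD: "finite D" using D finite_W finite_subset by blast
  have sing: "\<exists>v. spikes k = {v}" if "spikes k \<noteq> {}" for k
    using card_spikes[OF one[of k]] that by (metis card_1_singletonE)
  obtain v where v: "spikes n = {v}" using sing n by blast
  \<comment> \<open>The position before \<open>n\<close> on the cycle, reached by going
    around.\<close>
  define l where "l = n + len - 1"
  have l: "Suc l = n + len" "n < l" "Suc n < l" using len3 by (auto simp: l_def)
  \<comment> \<open>\<open>S\<close> is to be cut into blocks, and of the two vertices outside
    \<open>S\<close> the set \<open>D\<close> uses at most \<open>x\<close>. Then
    \<open>3 * dd W\<close> is at most \<open>3 * dd S + 3\<close>, hence at most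
    \<open>2 * card S + 3\<close>, which is \<open>2 * card W - 1\<close>.\<close>
  have key: "3 * dd W + 1 \<le> 2 * card W"
    if "D \<subseteq> insert x S" "finite S" "3 * dd S \<le> 2 * card S" "card W = card S + 2" for x S
    using card_dissoc_insert[OF D(2) that(1,2)] D(3) that(3,4) by linarith
  have "3 * dd W + 1 \<le> 2 * card W"
  proof (cases "vert n \<in> D \<and> v \<in> D")
    case False
    let ?S = "seg (Suc n) (n + len)"
    have full: "W = cell n \<union> ?S"
      using seg_full[of n] seg_split[of n "Suc n" "n + len"] us_ne by (simp add: seg_single Suc_leI)
    have "3 * dd ?S \<le> 2 * card ?S"
      by (rule block_word_dd[OF one]) (use gap_word_imp_block_word n l in auto)
    moreover have "card W = card ?S + 2" using card_W[of n] v by simp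
    moreover have "D \<subseteq> insert v ?S \<or> D \<subseteq> insert (vert n) ?S"
      using D(1) False full v by (auto simp: cell_def)
    ultimately show ?thesis using key finite_seg by blast
  next
    case True
    \<comment> \<open>Since \<open>D\<close> contains the spiked vertex and its spike, it misses the
      preceding vertex \<open>vert l\<close>. The word read from \<open>n\<close> itself and stopped
      before \<open>l\<close>, or one position earlier, is a block word by
      \<open>gap_word_butlast\<close>.\<close>
    have "vert (Suc l) = vert n" using l vert_periodic by simp
    then have "{vert l, vert n} \<in> E" using vert_edge[of l] by simp
    moreover have "{v, vert n} \<in> E" using spikes_edge[of v n] v edge_sym by blast
    moreover have "vert l \<noteq> v" using vert_notin_spikes[of l n] v by auto
    ultimately have nl: "vert l \<notin> D" using not_dissoc_path[OF finD, of "vert l" "vert n" v] True D by blast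
    have full: "W = seg n l \<union> cell l"
      using seg_full[of n] seg_split[of n l "n + len"] l(2) by (simp add: seg_single flip: l(1))
    have cardW: "card W = card (seg n l) + 1 + card (spikes l)"
      using seg_full[of n] card_seg_split[of n l "n + len"] l(2) by (simp add: seg_single card_cell flip: l(1))
    let ?bs = "word (Suc n) (n + len)"
    have bs: "?bs = word (Suc n) l @ [spikes l \<noteq> {}]"
      using word_append[of "Suc n" l "n + len"] l(3) by (simp add: word_Cons word_empty flip: l(1))
    have wn: "word n k = True # word (Suc n) k" if "n < k" for k using that n by (simp add: word_Cons)
    have gw: "if last ?bs then block_word (True # butlast ?bs)
      else 2 \<le> length ?bs \<and> block_word (True # butlast (butlast ?bs)) \<and> \<not> last (butlast ?bs)"
      using gap_word_butlast[OF n(2)] bs by simp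
    show ?thesis
    proof (cases "spikes l = {}")
      case False
      then obtain x where x: "spikes l = {x}" using sing by blast
      have "block_word (word n l)" using gw bs False wn l by simp
      then have "3 * dd (seg n l) \<le> 2 * card (seg n l)" using block_word_dd[OF one] l by simp
      moreover have "D \<subseteq> insert x (seg n l)" using D(1) full nl x by (auto simp: cell_def)
      ultimately show ?thesis using key[of x "seg n l"] finite_seg cardW x by simp
    next
      case True
      obtain k where k: "l = Suc k" "n < k" using l by (cases l) auto
      have ws: "word (Suc n) l = word (Suc n) k @ [spikes k \<noteq> {}]"
        using word_append[of "Suc n" k l] k by (simp add: word_Cons word_empty)
      have "butlast ?bs = word (Suc n) l" "\<not> last ?bs" using bs True by simp_all
      then have "block_word (True # butlast (word (Suc n) l)) \<and> \<not> last (word (Suc n) l)" using gw by simp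
      then have "block_word (word n k)" "spikes k = {}" using ws wn[OF k(2)] by simp_all
      then have "3 * dd (seg n k) \<le> 2 * card (seg n k)" using block_word_dd[OF one] k l by simp
      moreover have sk: "seg n l = seg n k \<union> cell k"
        using seg_split[of n k l] k by (simp add: seg_single)
      then have "D \<subseteq> insert (vert k) (seg n k)"
        using subset_trans[OF D(1) equalityD1[OF full]] nl True \<open>spikes k = {}\<close> by (auto simp: cell_def)
      moreover have "card (seg n l) = card (seg n k) + 1"
        using card_seg_split[of n k l] k l \<open>spikes k = {}\<close> by (simp add: seg_single card_cell)
      ultimately show ?thesis using key[of "vert k" "seg n k"] finite_seg cardW True by simp
    qed
  qed
  then show ?thesis using cycle_weight_W len unfolding excess_def by simp
qed

lemma very_good_excess:
  assumes one: "\<And>n. card (spikes n) \<le> 1"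
    and good: "very_good_spikes len {j. j < len \<and> spikes j \<noteq> {}}" (is "very_good_spikes _ ?I")
  shows "excess W \<le> 0"
proof -
  have len: "len mod 3 \<noteq> 1" and g: "good_spikes len ?I" using good by (auto simp: very_good_spikes_def)
  then have two: "2 \<le> card ?I"
    and gap: "\<And>i j. i \<in> ?I \<Longrightarrow> j \<in> ?I \<Longrightarrow> i < j \<Longrightarrow> (\<And>t. t \<in> ?I \<Longrightarrow> \<not> (i < t \<and> t < j)) \<Longrightarrow> (j - i) mod 3 = 2"
    and wrap: "(len + Min ?I - Max ?I) mod 3 = 1"
    unfolding good_spikes_def by auto
  have fin: "finite ?I" by simp
  have ne: "?I \<noteq> {}" using two by (metis card.empty not_numeral_le_zero)
  define s where "s = Min ?I"
  have s: "s \<in> ?I" using Min_in[OF fin ne] by (simp add: s_def)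
  define c where "c = (\<lambda>n. spikes n \<noteq> {})"
  \<comment> \<open>The window starts at the smallest spiked index. Its positions from
    \<open>len\<close> on repeat indices below that one and are therefore unspiked.\<close>
  have cI: "n \<in> ?I" if "s \<le> n" "n < s + len" "c n" for n
  proof (rule ccontr)
    assume neg: "n \<notin> ?I"
    then have "len \<le> n" using that by (auto simp: c_def)
    then have "spikes (n - len) \<noteq> {}" using that spikes_periodic[of "n - len"] by (simp add: c_def)
    moreover have "n - len < s" "s < len" using that \<open>len \<le> n\<close> s by auto
    ultimately have "s \<le> n - len" unfolding s_def by (intro Min_le[OF fin]) auto
    then show False using \<open>n - len < s\<close> by simp
  qed
  have "consecutive c s (s + len)" unfolding consecutive_def
  proof (intro conjI allI impI)
    fix i j assume a: "s \<le> i \<and> i < j \<and> j < s + len \<and> c i \<and> c j \<and> (\<forall>t. i < t \<and> t < j \<longrightarrow> \<not> c t)"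
    show "(j - i) mod 3 = 2"
    proof (rule gap)
      show "i \<in> ?I" "j \<in> ?I" "i < j" using a cI by auto
      show "\<not> (i < t \<and> t < j)" if "t \<in> ?I" for t using a that by (auto simp: c_def)
    qed
  next
    fix i assume a: "s \<le> i \<and> i < s + len \<and> c i \<and> (\<forall>t. i < t \<and> t < s + len \<longrightarrow> \<not> c t)"
    then have i: "i \<in> ?I" using cI by blast
    have "Max ?I = i"
    proof (rule Max_eqI[OF fin _ i])
      fix t assume "t \<in> ?I"
      then show "t \<le> i" using a by (auto simp: c_def not_le[symmetric])
    qed
    then show "(s + len - i) mod 3 = 1" using wrap by (simp add: s_def add.commute)
  qed
  then have "gap_word (map c [s + 1..<s + len])"
    by (rule consecutive_gap_word) (use s us_ne in \<open>auto simp: c_def\<close>)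
  then have "gap_word (word (Suc s) (s + len))" by (simp add: word_def c_def)
  then show ?thesis using gap_word_excess[OF one len] s by blast
qed

text \<open>A dissociation set misses some vertex of the cycle. The remaining path is cut into
  triples, with one further vertex left over if the length is \<open>2\<close> modulo
  \<open>3\<close>.\<close>

lemma no_spikes_excess:
  assumes none: "\<And>n. spikes n = {}" and len: "len mod 3 \<noteq> 0"
  shows "excess W \<le> 0"
proof -
  have one: "card (spikes n) \<le> 1" for n by (simp add: none)
  obtain D where D: "D \<subseteq> W" "dissoc D" "card D = dd W" using dd_obtain[OF finite_W] by metis
  have finD: "finite D" using D finite_W finite_subset by blast
  have ne: "vert 0 \<noteq> vert 2" using mod_close[of 0 2] len3 vert_eq_iff by auto
  have e: "{vert 0, vert 1} \<in> E" "{vert 2, vert 1} \<in> E"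
    using vert_edge[of 0] vert_edge[of 1] edge_sym by (simp_all add: numeral_2_eq_2 insert_commute)
  have "\<exists>n. vert n \<notin> D"
  proof (rule ccontr)
    assume "\<not> ?thesis"
    then show False using not_dissoc_path[OF finD e ne] D(2) by blast
  qed
  then obtain n where n: "vert n \<notin> D" by blast
  have full: "W = cell n \<union> seg (Suc n) (n + len)"
    using seg_full[of n] seg_split[of n "Suc n" "n + len"] us_ne by (simp add: seg_single Suc_leI)
  have "cell n = {vert n}" by (simp add: cell_def none)
  then have sub: "D \<subseteq> seg (Suc n) (n + len)" using subset_trans[OF D(1) equalityD1[OF full]] n by auto
  have w: "word s e = replicate (e - s) False" for s e
    unfolding word_def by (rule nth_equalityI) (auto simp: none)
  have card: "card W = len" using no_spikes_W[OF none] dist by (simp add: distinct_card)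
  show ?thesis
  proof (cases "len mod 3 = 1")
    case True
    have "gap_word (word (Suc n) (n + len))"
      unfolding w gap_word_replicate(2) using True us_ne mod_3_pred(2)[of 0 len] by simp
    then have "3 * dd (seg (Suc n) (n + len)) \<le> 2 * card (seg (Suc n) (n + len))"
      using gap_word_imp_block_word by (intro block_word_dd[OF one]) (auto simp: us_ne Suc_leI)
    moreover have "dd W \<le> dd (seg (Suc n) (n + len))" using dd_ge[OF finite_seg sub D(2)] D(3) by simp
    moreover have "card W = 1 + card (seg (Suc n) (n + len))" using card_W[of n] none by simp
    ultimately show ?thesis using cycle_weight_W True unfolding excess_def by simp
  next
    case False
    define l where "l = n + len - 1"
    have l: "Suc l = n + len" "Suc n < l" using len3 by (auto simp: l_def)
    have "l - Suc n = len - 2" by (simp add: l_def)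
    moreover have "(len - 2) mod 3 = 0" using False len len3 by presburger
    ultimately have "gap_word (word (Suc n) l)" unfolding w gap_word_replicate(2) by simp
    then have b: "3 * dd (seg (Suc n) l) \<le> 2 * card (seg (Suc n) l)"
      using gap_word_imp_block_word l by (intro block_word_dd[OF one]) auto
    have "seg (Suc n) (n + len) = seg (Suc n) l \<union> cell l"
      using seg_split[of "Suc n" l "n + len"] l(2) by (simp add: seg_single flip: l(1))
    then have "card D \<le> dd (seg (Suc n) l) + 1"
      by (intro card_dissoc_insert[OF D(2) _ finite_seg, of "vert l"]) (use sub none in \<open>auto simp: cell_def\<close>)
    moreover have "card (seg (Suc n) (n + len)) = card (seg (Suc n) l) + 1"
      using card_seg_split[of "Suc n" l "n + len"] l(2) none by (simp add: seg_single card_cell flip: l(1))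
    moreover have "card W = 1 + card (seg (Suc n) (n + len))" using card_W[of n] none by simp
    ultimately show ?thesis using cycle_weight_W False b D(3) unfolding excess_def by simp
  qed
qed

end

section \<open>The class as joins of pieces\<close>

text \<open>These are the base graphs, and also what the operations attach: \<open>O1\<close> and
  \<open>O2\<close> attach a path with three vertices by an end and by its middle. So the class
  arises from pieces by attaching further pieces with an edge.\<close>

definition piece :: "'a set \<Rightarrow> 'a set set \<Rightarrow> bool" where
  "piece V E \<longleftrightarrow> P3_graph V E \<or> (\<exists>l. cycle_graph V E l \<and> l mod 3 \<noteq> 0) \<or> very_good_spiked_cycle V E"

lemma piece_edges:
  assumes "piece V E" "e \<in> E"
  shows "e \<subseteq> V"
  using assms(1) unfolding piece_def
proof (elim disjE exE conjE)
  assume "P3_graph V E" then show ?thesis using assms(2) by (auto simp: P3_graph_def)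
next
  fix l assume "cycle_graph V E l"
  then show ?thesis using assms(2) cyc_edges_sub by (auto simp: cycle_graph_def)
next
  assume "very_good_spiked_cycle V E"
  then obtain us I w where "I \<subseteq> {0..<length us}" "V = set us \<union> w ` I"
    "E = cyc_edges us \<union> {{us ! i, w i} | i. i \<in> I}"
    unfolding very_good_spiked_cycle_def by blast
  then show ?thesis using assms(2) cyc_edges_sub[of e us] by fastforce
qed

lemma in_C_piece_induct [consumes 1, case_names piece attach]:
  assumes "in_C V E"
    and piece: "\<And>V E. piece V E \<Longrightarrow> Q V E"
    and attach: "\<And>V E P F x y. in_C V E \<Longrightarrow> Q V E \<Longrightarrow> piece P F \<Longrightarrow> V \<inter> P = {} \<Longrightarrow> x \<in> V \<Longrightarrow> y \<in> P \<Longrightarrow>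
      Q (V \<union> P) (E \<union> F \<union> {{x, y}})"
  shows "Q V E"
  using assms(1)
proof induction
  case (base_P3 V E) then show ?case using piece by (simp add: piece_def)
next
  case (base_cycle V E l) then show ?case using piece by (auto simp: piece_def)
next
  case (base_spiked V E) then show ?case using piece by (simp add: piece_def)
next
  case (O1 V E u v w x)
  have "P3_graph {u, v, w} {{u, v}, {v, w}}" using O1 by (auto simp: P3_graph_def)
  then have "Q (V \<union> {u, v, w}) (E \<union> {{u, v}, {v, w}} \<union> {{x, w}})"
    using O1 by (intro attach) (auto simp: piece_def)
  moreover have "E \<union> {{u, v}, {v, w}} \<union> {{x, w}} = E \<union> {{u, v}, {v, w}, {w, x}}"
    by (auto simp: insert_commute)
  ultimately show ?case by simp
next
  case (O2 V E v u u' x)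
  have "P3_graph {v, u, u'} {{v, u}, {v, u'}}" unfolding P3_graph_def
    using O2 by (intro exI[of _ u] exI[of _ v] exI[of _ u']) (auto simp: insert_commute)
  then have "Q (V \<union> {v, u, u'}) (E \<union> {{v, u}, {v, u'}} \<union> {{x, v}})"
    using O2 by (intro attach) (auto simp: piece_def)
  moreover have "E \<union> {{v, u}, {v, u'}} \<union> {{x, v}} = E \<union> {{v, u}, {v, u'}, {v, x}}"
    by (auto simp: insert_commute)
  ultimately show ?case by simp
next
  case (O3 V E Vc Ec l y x)
  then have "piece Vc Ec" by (auto simp: piece_def)
  then show ?case using attach[of V E Vc Ec x y] O3 by (simp add: Int_commute)
next
  case (O4 V E Vs Es y x)
  then have "piece Vs Es" by (auto simp: piece_def)
  then show ?case using attach[of V E Vs Es x y] O4 by (simp add: Int_commute)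
qed

lemma in_C_edges:
  assumes "in_C V E"
  shows "\<forall>e\<in>E. e \<subseteq> V"
  using assms
proof (induction rule: in_C_piece_induct)
  case (piece V E) then show ?case using piece_edges by blast
next
  case (attach V E P F x y) then show ?case using piece_edges[of P F] by blast
qed

lemma in_C_join_piece:
  assumes A: "in_C A F" and P: "piece P G" and dis: "A \<inter> P = {}" and a: "a \<in> A" and b: "b \<in> P"
  shows "in_C (A \<union> P) (F \<union> G \<union> {{a, b}})"
  using P unfolding piece_def
proof (elim disjE exE conjE)
  assume "P3_graph P G"
  then obtain p q r where pqr: "distinct [p, q, r]" "P = {p, q, r}" "G = {{p, q}, {q, r}}"
    unfolding P3_graph_def by blast
  have notin: "p \<notin> A" "q \<notin> A" "r \<notin> A" using pqr dis by auto
  consider "b = p" | "b = q" | "b = r" using b pqr by blast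
  then show ?thesis
  proof cases
    case 1
    have "in_C (A \<union> {r, q, p}) (F \<union> {{r, q}, {q, p}, {p, a}})"
      by (rule in_C.O1[OF A]) (use pqr notin a in auto)
    moreover have "F \<union> {{r, q}, {q, p}, {p, a}} = F \<union> G \<union> {{a, b}}"
      "A \<union> {r, q, p} = A \<union> P" using pqr 1 by (auto simp: insert_commute)
    ultimately show ?thesis by simp
  next
    case 2
    have "in_C (A \<union> {q, p, r}) (F \<union> {{q, p}, {q, r}, {q, a}})"
      by (rule in_C.O2[OF A]) (use pqr notin a in auto)
    moreover have "F \<union> {{q, p}, {q, r}, {q, a}} = F \<union> G \<union> {{a, b}}"
      "A \<union> {q, p, r} = A \<union> P" using pqr 2 by (auto simp: insert_commute)
    ultimately show ?thesis by simp
  next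
    case 3
    have "in_C (A \<union> {p, q, r}) (F \<union> {{p, q}, {q, r}, {r, a}})"
      by (rule in_C.O1[OF A]) (use pqr notin a in auto)
    moreover have "F \<union> {{p, q}, {q, r}, {r, a}} = F \<union> G \<union> {{a, b}}"
      using pqr 3 by (auto simp: insert_commute)
    ultimately show ?thesis using pqr by simp
  qed
next
  fix l assume "cycle_graph P G l" "l mod 3 \<noteq> 0"
  then show ?thesis using in_C.O3[OF A] dis a b by (simp add: Int_commute)
next
  assume "very_good_spiked_cycle P G"
  then show ?thesis using in_C.O4[OF A] dis a b by (simp add: Int_commute)
qed

text \<open>The operations attach only pieces, whereas a bridge separates two arbitrary members. The
  induction dismantles the second member while the first one grows, so \<open>A\<close> has to be
  arbitrary.\<close>

lemma in_C_join:
  assumes "in_C B G" "in_C A F" "A \<inter> B = {}" "a \<in> A" "b \<in> B"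
  shows "in_C (A \<union> B) (F \<union> G \<union> {{a, b}})"
  using assms
proof (induction arbitrary: A F a b rule: in_C_piece_induct)
  case (piece B G)
  show ?case by (rule in_C_join_piece[OF piece(2,1,3,4,5)])
next
  case (attach B G P H x y)
  show ?case
  proof (cases "b \<in> B")
    case True
    have "in_C (A \<union> B) (F \<union> G \<union> {{a, b}})" using attach True by blast
    then have "in_C (A \<union> B \<union> P) (F \<union> G \<union> {{a, b}} \<union> H \<union> {{x, y}})"
      by (rule in_C_join_piece) (use attach in auto)
    moreover have "F \<union> G \<union> {{a, b}} \<union> H \<union> {{x, y}} = F \<union> (G \<union> H \<union> {{x, y}}) \<union> {{a, b}}" by auto
    ultimately show ?thesis by (simp add: Un_assoc)
  next
    case False
    \<comment> \<open>The joining edge ends in the last piece, so this piece is moved over to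
      \<open>A\<close>; its former attaching edge becomes the joining edge to
      \<open>B\<close>.\<close>
    have "in_C (A \<union> P) (F \<union> H \<union> {{a, b}})"
      by (rule in_C_join_piece) (use attach False in auto)
    then have "in_C (A \<union> P \<union> B) (F \<union> H \<union> {{a, b}} \<union> G \<union> {{y, x}})"
      by (rule attach.IH) (use attach in auto)
    moreover have "A \<union> P \<union> B = A \<union> (B \<union> P)"
      "F \<union> H \<union> {{a, b}} \<union> G \<union> {{y, x}} = F \<union> (G \<union> H \<union> {{x, y}}) \<union> {{a, b}}"
      by (auto simp: insert_commute)
    ultimately show ?thesis by simp
  qed
qed

context cycle_disjoint_graph
begin

section \<open>The main induction\<close>

lemma edges_bridge:
  assumes br: "bridge A B a b"
  shows "{e \<in> E. e \<subseteq> A \<union> B} = {e \<in> E. e \<subseteq> A} \<union> {e \<in> E. e \<subseteq> B} \<union> {{a, b}}"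
proof (intro set_eqI iffI)
  fix e assume e: "e \<in> {e \<in> E. e \<subseteq> A \<union> B}"
  then have "card e = 2" using graph by (auto simp: graph_def)
  then obtain p q where pq: "e = {p, q}" by (auto simp: card_2_iff)
  have cross: "u = a \<and> v = b" if "u \<in> A" "v \<in> B" "{u, v} \<in> E" for u v
    using br that unfolding bridge_def by blast
  have "{p, q} \<in> E" "{q, p} \<in> E" "p \<in> A \<union> B" "q \<in> A \<union> B" using e pq edge_sym[of p q] by auto
  then show "e \<in> {e \<in> E. e \<subseteq> A} \<union> {e \<in> E. e \<subseteq> B} \<union> {{a, b}}"
    using cross[of p q] cross[of q p] pq by (auto simp: insert_commute)
next
  fix e assume "e \<in> {e \<in> E. e \<subseteq> A} \<union> {e \<in> E. e \<subseteq> B} \<union> {{a, b}}"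
  then show "e \<in> {e \<in> E. e \<subseteq> A \<union> B}" using br by (auto simp: bridge_def)
qed

text \<open>Both claims are proved together: nonnegativity of all proper subsets gives the structure
  of a connected set of excess at most \<open>0\<close>, and this structure shows that the excess is
  \<open>0\<close>.\<close>

lemma excess_nonneg_zero_in_C:
  assumes "W \<subseteq> V"
  shows "0 \<le> excess W \<and> (conn W \<and> excess W = 0 \<longrightarrow> in_C W {e \<in> E. e \<subseteq> W})"
  using assms
proof (induction "card W" arbitrary: W rule: less_induct)
  case less
  have fin: "finite W" using less.prems finite_sub by blast
  have IH: "0 \<le> excess U" "conn U \<Longrightarrow> excess U = 0 \<Longrightarrow> in_C U {e \<in> E. e \<subseteq> U}" if "U \<subset> W" for U
    using less.hyps[of U] psubset_card_mono[OF fin that] less.prems that by auto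
  show ?case
  proof (cases "conn W")
    case False
    have "0 \<le> excess W"
    proof (cases "W = {}")
      case True
      then show ?thesis using excess_dissoc[of "{}"] by (simp add: dissoc_def)
    next
      case ne: False
      then obtain A B where AB: "W = A \<union> B" "A \<inter> B = {}" "A \<noteq> {}" "B \<noteq> {}"
        "\<forall>a\<in>A. \<forall>b\<in>B. {a, b} \<notin> E" using False unfolding conn_def by blast
      then have "excess W = excess A + excess B" using excess_add[of A B] fin by simp
      moreover have "A \<subset> W" "B \<subset> W" using AB by auto
      ultimately show ?thesis using IH(1)[of A] IH(1)[of B] by linarith
    qed
    then show ?thesis using False by simp
  next
    case conn: True
    show ?thesis
    proof (cases "excess W \<le> 0")
      case True
      then have "zero_bridge W \<or> pendant_bridges W" using excess_le_0_cases[OF fin _ True] IH(1) by blast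
      then show ?thesis
      proof
        assume "zero_bridge W"
        then obtain A B a b where s: "W = A \<union> B" "bridge A B a b" "conn A" "conn B" "excess A = 0" "excess B = 0"
          unfolding zero_bridge_def by blast
        have f: "finite A" "finite B" using fin s(1) by auto
        have sub: "A \<subset> W" "B \<subset> W" and dis: "A \<inter> B = {}" "a \<in> A" "b \<in> B" using s(1,2) by (auto simp: bridge_def)
        have "\<forall>U. U \<subset> A \<union> B \<longrightarrow> 0 \<le> excess U" using IH(1) s(1) by blast
        then have "excess W = 0" using bridge_zero_side(2)[OF f s(2)] True s(1,5) by simp
        moreover have "in_C W {e \<in> E. e \<subseteq> W}"
          using in_C_join[OF IH(2)[OF sub(2) s(4,6)] IH(2)[OF sub(1) s(3,5)] dis]
            edges_bridge[OF s(2)] s(1) by simp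
        ultimately show ?thesis by simp
      next
        assume pend: "pendant_bridges W"
        show ?thesis
        proof (cases "cycles W = {}")
          case acyc: True
          then show ?thesis using pendant_tree[OF less.prems conn pend acyc] by simp
        next
          case False
          then obtain us where us: "cyc_list W E us" by (auto simp: cycles_def)
          interpret spiked_cycle V E W us
          proof
            show "W \<subseteq> V" "cyc_list W E us" using less.prems us by auto
            show "\<exists>u\<in>set us. {u, w} \<in> E" if "w \<in> W - set us" for w
              using pendant_cycle_structure(1)[OF less.prems conn pend us that] .
            show "v = u" if "u \<in> set us" "w \<in> W - set us" "{u, w} \<in> E" "v \<in> W" "{w, v} \<in> E" for u w v
              using pendant_cycle_structure(2)[OF less.prems conn pend us that] .
          qed
          show ?thesis using spiked_cycle_classify[OF IH(1) True] by simp
        qed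
      qed
    qed simp
  qed
qed

section \<open>Members of the class have excess at most zero\<close>

lemma P3_excess:
  assumes "W \<subseteq> V" "P3_graph W {e \<in> E. e \<subseteq> W}"
  shows "excess W \<le> 0"
proof -
  obtain a b c where abc: "distinct [a, b, c]" "W = {a, b, c}" "{e \<in> E. e \<subseteq> W} = {{a, b}, {b, c}}"
    using assms unfolding P3_graph_def by blast
  have "{a, b} \<in> {e \<in> E. e \<subseteq> W}" "{b, c} \<in> {e \<in> E. e \<subseteq> W}" using abc(3) by simp_all
  then have e: "{a, b} \<in> E" "{c, b} \<in> E" using edge_sym by blast+
  have "dd W \<le> 2" by (rule dd_triple[OF _ _ e]) (use abc in auto)
  moreover have "cycles W = {}"
  proof (rule ccontr)
    assume "cycles W \<noteq> {}"
    then obtain xs where xs: "cyc_list W E xs" by (auto simp: cycles_def)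
    then have "cyc_edges xs \<subseteq> {e \<in> E. e \<subseteq> W}" using cyc_edges_sub unfolding cyc_list_def by blast
    then have "card (cyc_edges xs) \<le> card {{a, b}, {b, c}}" unfolding abc(3) by (intro card_mono) auto
    also have "\<dots> \<le> 2" by (simp add: card_insert_if)
    finally show False using xs card_cyc_edges[of xs] by (simp add: cyc_list_def)
  qed
  ultimately show ?thesis using abc(1,2) by (simp add: excess_def cycle_weight_def)
qed

lemma cycle_graph_excess:
  assumes W: "W \<subseteq> V" and "cycle_graph W {e \<in> E. e \<subseteq> W} l" and l: "l mod 3 \<noteq> 0"
  shows "excess W \<le> 0"
proof -
  obtain us where h: "length us = l" "3 \<le> l" "distinct us" "W = set us" "{e \<in> E. e \<subseteq> W} = cyc_edges us"
    using assms unfolding cycle_graph_def by blast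
  interpret spiked_cycle V E W us
  proof
    show "cyc_list W E us" unfolding cyc_list_def using h by blast
  qed (use W h(4) in auto)
  have "spikes n = {}" for n unfolding spikes_def using h(4) by blast
  then show ?thesis using no_spikes_excess l h(1) by blast
qed

lemma very_good_spiked_cycle_excess:
  assumes W: "W \<subseteq> V" and "very_good_spiked_cycle W {e \<in> E. e \<subseteq> W}"
  shows "excess W \<le> 0"
proof -
  obtain us I w where h: "3 \<le> length us" "distinct us" and I: "I \<subseteq> {0..<length us}"
    and w: "inj_on w I" "w ` I \<inter> set us = {}" and Weq: "W = set us \<union> w ` I"
    and Eeq: "{e \<in> E. e \<subseteq> W} = cyc_edges us \<union> {{us ! i, w i} | i. i \<in> I}"
    and good: "very_good_spikes (length us) I"
    using assms(2) unfolding very_good_spiked_cycle_def by (elim exE conjE) (rule that; assumption)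
  have edge: "\<exists>i\<in>I. x = w i \<and> v = us ! i" if "x \<in> W - set us" "v \<in> W" "{x, v} \<in> E" for x v
  proof -
    have "{x, v} \<in> {e \<in> E. e \<subseteq> W}" using that by simp
    moreover have "{x, v} \<notin> cyc_edges us" using that cyc_edges_sub by blast
    ultimately obtain i where i: "i \<in> I" "{x, v} = {us ! i, w i}" unfolding Eeq by blast
    then have "us ! i \<in> set us" using I by auto
    then have "x \<noteq> us ! i" using that by auto
    then show ?thesis using i by (auto simp: doubleton_eq_iff)
  qed
  have spike: "{us ! i, w i} \<in> E" if "i \<in> I" for i using Eeq that by blast
  interpret spiked_cycle V E W us
  proof
    show "W \<subseteq> V" by fact
    show "cyc_list W E us" unfolding cyc_list_def using h Weq Eeq by blast
    show "\<exists>u\<in>set us. {u, x} \<in> E" if x: "x \<in> W - set us" for x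
    proof -
      obtain i where "i \<in> I" "x = w i" using x unfolding Weq by blast
      then show ?thesis using spike I by (intro bexI[of _ "us ! i"]) auto
    qed
    show "v = u" if uv: "u \<in> set us" "x \<in> W - set us" "{u, x} \<in> E" "v \<in> W" "{x, v} \<in> E" for u x v
    proof -
      have "{x, u} \<in> E" "u \<in> W" using uv(1,3) edge_sym Weq by blast+
      then obtain i where i: "i \<in> I" "x = w i" "u = us ! i" using edge[OF uv(2)] by blast
      obtain j where j: "j \<in> I" "x = w j" "v = us ! j" using edge[OF uv(2,4,5)] by blast
      then have "i = j" using i w(1) by (auto dest: inj_onD)
      then show ?thesis using i j by simp
    qed
  qed
  \<comment> \<open>Identifies the pendant vertices found from \<open>E\<close> with the given
    spikes, so that the set of spiked positions is \<open>I\<close>.\<close>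
  have sp: "spikes j = (if j \<in> I then {w j} else {})" if j: "j < len" for j
  proof -
    have v: "vert j = us ! j" using j by (simp add: vert_def)
    have "x = w j \<and> j \<in> I" if x: "x \<in> spikes j" for x
    proof -
      have "{x, us ! j} \<in> E" "x \<in> W - set us" using x v edge_sym by (auto simp: spikes_def)
      then obtain i where i: "i \<in> I" "x = w i" "us ! j = us ! i" using edge[of x "us ! j"] j Weq by auto
      then have "i = j" using I j h(2) by (auto simp: nth_eq_iff_index_eq)
      then show ?thesis using i by simp
    qed
    moreover have "w j \<in> spikes j" if "j \<in> I"
    proof -
      have "w j \<in> W - set us" using that w(2) Weq by blast
      then show ?thesis using spike[OF that] v by (simp add: spikes_def)
    qed
    ultimately show ?thesis by auto
  qed
  have "card (spikes n) \<le> 1" for n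
  proof -
    have "spikes n = spikes (n mod len)" by (simp add: spikes_def vert_def)
    then show ?thesis using sp[OF mod_len[of n]] by simp
  qed
  moreover have "{j. j < len \<and> spikes j \<noteq> {}} = I" using sp I by auto
  ultimately show ?thesis using very_good_excess good by simp
qed

lemma piece_excess:
  assumes "W \<subseteq> V" "piece W {e \<in> E. e \<subseteq> W}"
  shows "excess W \<le> 0"
  using assms(2) unfolding piece_def
proof (elim disjE exE conjE)
  assume "P3_graph W {e \<in> E. e \<subseteq> W}" then show ?thesis by (rule P3_excess[OF assms(1)])
next
  fix l assume "cycle_graph W {e \<in> E. e \<subseteq> W} l" "l mod 3 \<noteq> 0"
  then show ?thesis by (rule cycle_graph_excess[OF assms(1)])
next
  assume "very_good_spiked_cycle W {e \<in> E. e \<subseteq> W}"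
  then show ?thesis by (rule very_good_spiked_cycle_excess[OF assms(1)])
qed

text \<open>The excess refers to the ambient \<open>E\<close>, so the edge sets of both parts must
  be recovered as exactly the induced ones. This works because the attaching edge is the only edge
  between the two parts.\<close>

lemma in_C_excess:
  assumes "in_C W F" "W \<subseteq> V" "F = {e \<in> E. e \<subseteq> W}"
  shows "excess W \<le> 0"
  using assms
proof (induction rule: in_C_piece_induct)
  case (piece W F)
  then show ?case using piece_excess by blast
next
  case (attach W F P G x y)
  have F: "e \<subseteq> W" if "e \<in> F" for e using in_C_edges[OF attach.hyps(1)] that by blast
  have G: "e \<subseteq> P" if "e \<in> G" for e using piece_edges[OF attach.hyps(2)] that by blast
  have ne: "e \<noteq> {}" if "e \<in> E" for e using graph that by (auto simp: graph_def)
  have xy: "\<not> {x, y} \<subseteq> W" "\<not> {x, y} \<subseteq> P" using attach.hyps(3-5) by auto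
  have in_E: "e \<in> F \<union> G \<union> {{x, y}} \<longleftrightarrow> e \<in> E \<and> e \<subseteq> W \<union> P" for e unfolding attach.prems(2) by simp
  have not_both: "\<not> (e \<subseteq> W \<and> e \<subseteq> P)" if "e \<in> E" for e using ne[OF that] attach.hyps(3) by blast
  have "F = {e \<in> E. e \<subseteq> W}"
  proof (intro set_eqI iffI)
    fix e assume "e \<in> F" then show "e \<in> {e \<in> E. e \<subseteq> W}" using in_E[of e] F by blast
  next
    fix e assume e: "e \<in> {e \<in> E. e \<subseteq> W}"
    then have "e \<in> F \<union> G \<union> {{x, y}}" using in_E[of e] by blast
    then show "e \<in> F" using e G[of e] xy not_both[of e] by blast
  qed
  then have eW: "excess W \<le> 0" using attach.IH attach.prems(1) by blast
  have "G = {e \<in> E. e \<subseteq> P}"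
  proof (intro set_eqI iffI)
    fix e assume "e \<in> G" then show "e \<in> {e \<in> E. e \<subseteq> P}" using in_E[of e] G by blast
  next
    fix e assume e: "e \<in> {e \<in> E. e \<subseteq> P}"
    then have "e \<in> F \<union> G \<union> {{x, y}}" using in_E[of e] by blast
    then show "e \<in> G" using e F[of e] xy not_both[of e] by blast
  qed
  then have eP: "excess P \<le> 0" using piece_excess[of P] attach.hyps(2) attach.prems(1) by simp
  have cross: "u = x \<and> v = y" if uv: "u \<in> W" "v \<in> P" "{u, v} \<in> E" for u v
  proof -
    have "{u, v} \<in> F \<union> G \<union> {{x, y}}" using in_E[of "{u, v}"] uv by blast
    moreover have "{u, v} \<notin> F" using F[of "{u, v}"] uv attach.hyps(3) by blast
    moreover have "{u, v} \<notin> G" using G[of "{u, v}"] uv attach.hyps(3) by blast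
    ultimately have "{u, v} = {x, y}" by blast
    then show ?thesis using uv attach.hyps(3-5) by (auto simp: doubleton_eq_iff)
  qed
  have "excess (W \<union> P) \<le> excess W + excess P"
    by (rule excess_join_le[OF _ _ attach.hyps(3) cross]) (use attach.prems(1) finite_sub in auto)
  then show ?case using eW eP by simp
qed

text \<open>At a bridge both sides are handled by induction. Without bridges every edge lies on a
  cycle, and an edge leaving a cycle would lie on a second one meeting it; so \<open>W\<close> is a
  single vertex or a single cycle.\<close>

lemma card_edges_conn:
  assumes "W \<subseteq> V" "conn W"
  shows "card {e \<in> E. e \<subseteq> W} + 1 = card W + card (cycles W)"
  using assms
proof (induction "card W" arbitrary: W rule: less_induct)
  case less
  note W = less.prems
  have fin: "finite W" using W finite_sub by blast
  have finE: "finite {e \<in> E. e \<subseteq> U}" if "U \<subseteq> V" for U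
    by (rule finite_subset[of _ "Pow U"]) (use finite_sub[OF that] in auto)
  show ?case
  proof (cases "\<exists>A B a b. W = A \<union> B \<and> bridge A B a b \<and> conn A \<and> conn B")
    case True
    then obtain A B a b where s: "W = A \<union> B" "bridge A B a b" "conn A" "conn B" by blast
    have dis: "A \<inter> B = {}" "a \<in> A" "b \<in> B" "{a, b} \<in> E" using s(2) by (auto simp: bridge_def)
    have f: "finite A" "finite B" using fin s(1) by auto
    have AV: "A \<subseteq> V" "B \<subseteq> V" using W s(1) by auto
    have sub: "A \<subset> W" "B \<subset> W" using s(1) dis by auto
    have IH: "card {e \<in> E. e \<subseteq> A} + 1 = card A + card (cycles A)"
      "card {e \<in> E. e \<subseteq> B} + 1 = card B + card (cycles B)"
      using less.hyps psubset_card_mono[OF fin] sub AV s(3,4) by blast+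
    have "{e \<in> E. e \<subseteq> A} \<inter> {e \<in> E. e \<subseteq> B} = {}"
    proof -
      have "e \<notin> E" if "e \<subseteq> A" "e \<subseteq> B" for e
      proof -
        have "e = {}" using that dis by blast
        then show ?thesis using graph by (auto simp: graph_def)
      qed
      then show ?thesis by blast
    qed
    moreover have "{a, b} \<notin> {e \<in> E. e \<subseteq> A} \<union> {e \<in> E. e \<subseteq> B}" using dis by auto
    ultimately have "card {e \<in> E. e \<subseteq> W} = card {e \<in> E. e \<subseteq> A} + card {e \<in> E. e \<subseteq> B} + 1"
      unfolding s(1) edges_bridge[OF s(2)] using finE[OF AV(1)] finE[OF AV(2)]
      by (simp add: card_Un_disjoint)
    moreover have "card W = card A + card B" using card_bridge[OF f s(2)] s(1) by simp
    moreover have "cycles W = cycles A \<union> cycles B"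
      unfolding s(1) by (rule cycles_union[OF dis(1)]) (use s(2) in \<open>auto simp: bridge_def\<close>)
    then have "card (cycles W) = card (cycles A) + card (cycles B)"
      using cycles_disjoint[OF dis(1)] f finite_cycles by (simp add: card_Un_disjoint)
    ultimately show ?thesis using IH by simp
  next
    case False
    have in_cycle: "\<exists>xs. cyc_list W E xs \<and> {a, b} \<in> cyc_edges xs"
      if "{a, b} \<in> E" "a \<in> W" "b \<in> W" for a b
      using edge_cases[OF W(2) that] False by metis
    obtain p where p: "p \<in> W" using W by (auto simp: conn_def)
    show ?thesis
    proof (cases "W = {p}")
      case True
      have "{e \<in> E. e \<subseteq> W} = {}"
      proof (rule ccontr)
        assume "{e \<in> E. e \<subseteq> W} \<noteq> {}"
        then obtain e where "e \<in> E" "e \<subseteq> {p}" using True by blast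
        then have "card e \<le> 1" "card e = 2" using card_mono[of "{p}" e] graph by (auto simp: graph_def)
        then show False by simp
      qed
      moreover have "cycles W = {}"
      proof (rule ccontr)
        assume "cycles W \<noteq> {}"
        then obtain C where "C \<in> cycles W" by blast
        then have "3 \<le> card C" "card C \<le> card W"
          using cycles_card card_mono[OF fin cycles_sub] by simp_all
        then show False using True by simp
      qed
      ultimately show ?thesis using True by simp
    next
      case ne: False
      then obtain q where "q \<in> W" "{p, q} \<in> E" using conn_edge_out[OF W(2), of "{p}"] p by auto
      then obtain xs where xs: "cyc_list W E xs" using in_cycle p by blast
      have xsV: "cyc_list V E xs" using xs W cyc_list_mono by blast
      have sub: "set xs \<subseteq> W" "set xs \<noteq> {}" using xs by (auto simp: cyc_list_def)
      have "W = set xs"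
      proof (rule ccontr)
        assume "W \<noteq> set xs"
        then obtain u v where uv: "u \<in> set xs" "v \<in> W - set xs" "{u, v} \<in> E"
          using conn_edge_out[OF W(2) sub] by metis
        then obtain ys where ys: "cyc_list W E ys" "{u, v} \<in> cyc_edges ys" using in_cycle sub by blast
        have "u \<in> set ys" "v \<in> set ys" using cyc_edges_sub[OF ys(2)] by auto
        moreover have "cyc_list V E ys" using ys(1) W(1) cyc_list_mono by blast
        ultimately show False using cyc_list_meet(2)[OF xsV, of ys] uv by blast
      qed
      then show ?thesis
        using cyc_list_induced[OF xsV] cycles_in_cycle[OF xsV] card_cyc_edges[of xs] xs
        by (simp add: cyc_list_def distinct_card)
    qed
  qed
qed

section \<open>Translation to the notions of the theorem\<close>

lemma conn_if_connected_graph: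
  assumes "connected_graph V E"
  shows "conn V"
  unfolding conn_def
proof (intro conjI allI impI)
  show "V \<noteq> {}" using assms by (simp add: connected_graph_def)
  fix A B assume AB: "V = A \<union> B \<and> A \<inter> B = {} \<and> A \<noteq> {} \<and> B \<noteq> {}"
  then obtain a b where ab: "a \<in> A" "b \<in> B" by blast
  show "\<exists>a\<in>A. \<exists>b\<in>B. {a, b} \<in> E"
  proof (rule ccontr)
    assume neg: "\<not> ?thesis"
    have "(a, b) \<in> {(x, y). {x, y} \<in> E}\<^sup>*" using assms ab AB unfolding connected_graph_def by blast
    then have "b \<in> A"
    proof (induction rule: rtrancl_induct)
      case base show ?case by (rule ab)
    next
      case (step y z) then show ?case using neg AB edge_in_V[of y z] by blast
    qed
    then show False using ab AB by blast
  qed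
qed

lemma diss_eq_dd: "diss V E = dd V"
  unfolding diss_def dd_def dissociation_set_def dissoc_def ..

text \<open>All cycles are induced here, so counting the induced ones is counting vertex sets of
  cycles.\<close>

lemma c1_eq: "c1 V E = card {C \<in> cycles V. card C mod 3 = 1}"
proof -
  have "{set xs | xs. induced_cycle V E xs \<and> length xs mod 3 = 1} = {C \<in> cycles V. card C mod 3 = 1}"
  proof (intro set_eqI iffI)
    fix C assume "C \<in> {set xs | xs. induced_cycle V E xs \<and> length xs mod 3 = 1}"
    then obtain xs where xs: "C = set xs" "cyc_list V E xs" "length xs mod 3 = 1"
      unfolding induced_cycle_def by blast
    then have "card C = length xs" by (simp add: distinct_card cyc_list_def)
    then show "C \<in> {C \<in> cycles V. card C mod 3 = 1}" using xs by (auto simp: cycles_def)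
  next
    fix C assume "C \<in> {C \<in> cycles V. card C mod 3 = 1}"
    then obtain xs where xs: "C = set xs" "cyc_list V E xs" "card C mod 3 = 1"
      unfolding cycles_def by blast
    then have "length xs mod 3 = 1" by (simp add: distinct_card cyc_list_def)
    moreover have "induced_cycle V E xs" using xs(2) cyc_list_induced by (simp add: induced_cycle_def)
    ultimately show "C \<in> {set xs | xs. induced_cycle V E xs \<and> length xs mod 3 = 1}" using xs(1) by blast
  qed
  then show ?thesis by (simp add: c1_def)
qed

lemma cycle_weight_V: "cycle_weight V = int (card (cycles V)) + int (c1 V E)"
proof -
  have fin: "finite (cycles V)" using finite_cycles finite_V by blast
  have "cycle_weight V = (\<Sum>C\<in>cycles V. 1 + (if card C mod 3 = 1 then 1 else 0))"
    unfolding cycle_weight_def weight_def by (intro sum.cong) auto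
  also have "\<dots> = int (card (cycles V)) + (\<Sum>C\<in>cycles V. if card C mod 3 = 1 then 1 else 0)"
    by (simp add: sum.distrib)
  also have "(\<Sum>C\<in>cycles V. if card C mod 3 = 1 then 1 else 0) = int (c1 V E)"
    unfolding c1_eq using fin by (simp add: sum.If_cases Collect_conj_eq)
  finally show ?thesis .
qed

end

theorem theorem3:
  fixes V :: "'a set" and E :: "'a set set"
  assumes "graph V E" and "connected_graph V E" and "cycle_disjoint V E"
  shows "real (diss V E) = real (card V) - (real (card E) + 1 + real (c1 V E)) / 3
         \<longleftrightarrow> in_C V E"
proof -
  interpret cycle_disjoint_graph V E by (rule cycle_disjoint_graph.intro) fact+
  have conn: "conn V" using conn_if_connected_graph assms(2) by blast
  have E: "{e \<in> E. e \<subseteq> V} = E" using assms(1) by (auto simp: graph_def)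
  have m: "card E + 1 = card V + card (cycles V)" using card_edges_conn[OF subset_refl conn] E by simp
  have "excess V = 3 * int (diss V E) + (int (card E) + 1 + int (c1 V E)) - 3 * int (card V)"
    unfolding excess_def diss_eq_dd cycle_weight_V using m by simp
  then have "real_of_int (excess V) = 3 * real (diss V E) + (real (card E) + 1 + real (c1 V E)) - 3 * real (card V)"
    by simp
  then have "real (diss V E) = real (card V) - (real (card E) + 1 + real (c1 V E)) / 3 \<longleftrightarrow> excess V = 0"
    by (auto simp: field_simps)
  moreover have "excess V = 0 \<longleftrightarrow> in_C V E"
  proof
    assume "excess V = 0"
    then show "in_C V E" using excess_nonneg_zero_in_C[OF subset_refl] conn E by simp
  next
    assume "in_C V E"
    then have "excess V \<le> 0" using in_C_excess[OF _ subset_refl] E by simp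
    then show "excess V = 0" using excess_nonneg_zero_in_C[OF subset_refl] by simp
  qed
  ultimately show ?thesis by simp
qed

end
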